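(* Consider the finite-sum problem of minimizing $f=\sum_{v\in\mathcal V}\pi(v)f^v$ over $\Theta$, with recurrent data sampling $(v_n)_{n\ge1}$ (i.e. $\sup_{n\ge1}\|\mathbb E[\tau_{n,v}\mid\mathcal F_n]\|_\infty<\infty$ for every $v\in\mathcal V$), and assume that each $f^v$ is bounded below on $\Theta$ and that the directional derivative $\nabla f^v(\theta,\theta'-\theta)$ exists for all $v\in\mathcal V$ and $\theta,\theta'\in\Theta$. (i) If $(\theta_n)_{n\ge0}$ is generated by Algorithm 1 with dynamic regularization (with $\rho+\mu>0$), then $\lim_{n\to\infty}\mathbb E[O_f(\theta_n)]=0$ and $\lim_{n\to\infty}\mathbb E[O_f(\theta_n)^2]=0$. (ii) Assume in addition that each $f^v$ is continuously differentiable with $L$-Lipschitz gradient (same constant $L$ as for the surrogates), and that $(r_n)_{n\ge1}$ is a non-increasing sequence of positive numbers with $\sum_n r_n=\infty$ and $\sum_n r_n^2<\infty$. If $(\theta_n)_{n\ge0}$ is generated by Algorithm 2 with radii $(r_n)$, then almost surely every limit point in $\Theta$ of $(\theta_n)_{n\ge1}$ is a stationary point of $f$ over $\Theta$.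
   Context: Problem: $\mathcal V$ is a finite nonempty set, $\pi(v)\ge0$ with $\sum_{v\in\mathcal V}\pi(v)=1$; $\Theta\subseteq\mathbb R^p$ is a nonempty convex set (not necessarily compact); $f^v:\mathbb R^p\to\mathbb R$ for $v\in\mathcal V$ and $f=\sum_v\pi(v)f^v$. $\|\cdot\|$ is the Euclidean norm, $B_r(\theta)$ the closed ball. Directional derivative and optimality: $\nabla f(\theta^*,\theta-\theta^* )=\lim_{\alpha\to0^+}\alpha^{-1}\big(f(\theta^*+\alpha(\theta-\theta^* ))-f(\theta^* )\big)$ and $O_f(\theta^* )=\sup_{\theta\in\Theta,\ \|\theta-\theta^*\|\le1}-\nabla f(\theta^*,\theta-\theta^* )$ for $\theta^*\in\Theta$. A point $\theta^*\in\Theta$ is a stationary point of $f$ over $\Theta$ if $O_f(\theta^* )=0$. A limit point of a sequence is a limit of some subsequence. Surrogates: fix $L>0$. For $\phi:\mathbb R^p\to\mathbb R$ and $\theta\in\Theta$, $\mathcal S_L(\phi,\theta)$ is the set of convex functions $g:\mathbb R^p\to\mathbb R$ such that $g\ge\phi$ on $\Theta$, and $h=g-\phi$ is differentiable with $L$-Lipschitz gradient, $h(\theta)=0$, $\nabla h(\theta)=0$. For $\mu\ge0$, $\mathcal S_{L,\mu}(\phi,\theta)$ is the set of $\mu$-strongly convex $g\in\mathcal S_L(\phi,\theta)$ ($0$-strongly convex means convex). Sampling: $(v_n)_{n\ge1}$ is an arbitrary $\mathcal V$-valued stochastic process; $\tau_{n,v}=\inf\{j\ge1:v_{n+j}=v\}$;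 $k^v(n)=\sup\{1\le j\le n:v_j=v\}$, with $k^v(n)=1$ if $v$ was not visited by time $n$. $\mathcal F_n$ is the $\sigma$-algebra generated by $v_1,\dots,v_n,\theta_0,\dots,\theta_n$. $\|X\|_\infty=\inf\{t>0:\mathbb P(|X|>t)=0\}$. Algorithm 1 with dynamic regularization (parameters $\rho,\mu\ge0$): start from a fixed $\theta_0\in\Theta$ and $g_0^v\in\mathcal S_{L,\mu}(f^v,\theta_0)$ for all $v$. For $n\ge1$: observe $v_n$; choose $g_n^{v_n}\in\mathcal S_{L,\mu}(f^{v_n},\theta_{n-1})$, and set $g_n^v=g_{n-1}^v$ for $v\ne v_n$; set $\bar g_n=\sum_v\pi(v)g_n^v$; let $\theta_n\in\arg\min_{\theta\in\Theta}\big[\bar g_n(\theta)+\frac{\rho_n}2\|\theta-\theta_{n-1}\|^2\big]$, where $\rho_n=\rho+\max_{v}(n-k^v(n))$. Algorithm 2 (radii $r_n>0$): the same with surrogates in $\mathcal S_L$ instead of $\mathcal S_{L,\mu}$, and with $\theta_n\in\arg\min_{\theta\in\Theta\cap B_{r_n}(\theta_{n-1})}\bar g_n(\theta)$. *)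

theory Defs
  imports "HOL-Probability.Probability"
begin

subsection \<open>Directional derivatives and stationarity\<close>

definition dir_quotient :: "('a::real_normed_vector \<Rightarrow> real) \<Rightarrow> 'a \<Rightarrow> 'a \<Rightarrow> real \<Rightarrow> real"
  where "dir_quotient f x d = (\<lambda>\<alpha>. (f (x + \<alpha> *\<^sub>R d) - f x) / \<alpha>)"

definition has_dir_deriv :: "('a::real_normed_vector \<Rightarrow> real) \<Rightarrow> 'a \<Rightarrow> 'a \<Rightarrow> bool"
  where "has_dir_deriv f x d \<longleftrightarrow> (\<exists>l. (dir_quotient f x d \<longlongrightarrow> l) (at_right 0))"

definition dir_deriv :: "('a::real_normed_vector \<Rightarrow> real) \<Rightarrow> 'a \<Rightarrow> 'a \<Rightarrow> real"
  where "dir_deriv f x d = Lim (at_right 0) (dir_quotient f x d)"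

text \<open>The supremum is taken in the extended reals, so that it needs no boundedness assumption.
  It is nonnegative whenever \<open>x \<in> \<Theta>\<close>, since \<open>y = x\<close> contributes \<open>0\<close>.\<close>

definition opt_gap :: "'a::real_normed_vector set \<Rightarrow> ('a \<Rightarrow> real) \<Rightarrow> 'a \<Rightarrow> ereal"
  where "opt_gap \<Theta> f x = (SUP y\<in>{y \<in> \<Theta>. norm (y - x) \<le> 1}. ereal (- dir_deriv f x (y - x)))"

definition stationary_point :: "'a::real_normed_vector set \<Rightarrow> ('a \<Rightarrow> real) \<Rightarrow> 'a \<Rightarrow> bool"
  where "stationary_point \<Theta> f x \<longleftrightarrow> x \<in> \<Theta> \<and> opt_gap \<Theta> f x = 0"

definition seq_limit_point :: "(nat \<Rightarrow> 'a::topological_space) \<Rightarrow> 'a \<Rightarrow> bool"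
  where "seq_limit_point X x \<longleftrightarrow> (\<exists>s. strict_mono s \<and> (X \<circ> s) \<longlonglongrightarrow> x)"

subsection \<open>Surrogates\<close>

definition lipschitz_gradient :: "real \<Rightarrow> ('a::real_inner \<Rightarrow> real) \<Rightarrow> bool"
  where "lipschitz_gradient L h \<longleftrightarrow> (\<exists>G. (\<forall>x. GDERIV h x :> G x) \<and> L-lipschitz_on UNIV G)"

definition strongly_convex :: "real \<Rightarrow> ('a::real_inner \<Rightarrow> real) \<Rightarrow> bool"
  where "strongly_convex \<mu> g \<longleftrightarrow> convex_on UNIV (\<lambda>x. g x - \<mu> / 2 * (norm x)\<^sup>2)"

definition surrogates ::
    "'a::real_inner set \<Rightarrow> real \<Rightarrow> ('a \<Rightarrow> real) \<Rightarrow> 'a \<Rightarrow> ('a \<Rightarrow> real) set"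
  where "surrogates \<Theta> L \<phi> \<theta> = {g. convex_on UNIV g \<and> (\<forall>x\<in>\<Theta>. \<phi> x \<le> g x) \<and>
    lipschitz_gradient L (\<lambda>x. g x - \<phi> x) \<and> g \<theta> - \<phi> \<theta> = 0 \<and> GDERIV (\<lambda>x. g x - \<phi> x) \<theta> :> 0}"

definition strong_surrogates ::
    "'a::real_inner set \<Rightarrow> real \<Rightarrow> real \<Rightarrow> ('a \<Rightarrow> real) \<Rightarrow> 'a \<Rightarrow> ('a \<Rightarrow> real) set"
  where "strong_surrogates \<Theta> L \<mu> \<phi> \<theta> = {g \<in> surrogates \<Theta> L \<phi> \<theta>. strongly_convex \<mu> g}"

definition weighted_sum :: "'v set \<Rightarrow> ('v \<Rightarrow> real) \<Rightarrow> ('v \<Rightarrow> 'a \<Rightarrow> real) \<Rightarrow> 'a \<Rightarrow> real"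
  where "weighted_sum V p f = (\<lambda>x. \<Sum>u\<in>V. p u * f u x)"

subsection \<open>Sampling\<close>

text \<open>In the next two definitions \<open>v\<close> is a single sample path; its entry \<open>v 0\<close> is never used.
  The return time is \<open>\<infinity>\<close> (infimum of the empty set) if \<open>u\<close> is not visited after time \<open>n\<close>.\<close>

definition return_time :: "(nat \<Rightarrow> 'v) \<Rightarrow> nat \<Rightarrow> 'v \<Rightarrow> ennreal"
  where "return_time v n u = (INF j\<in>{j. 1 \<le> j \<and> v (n + j) = u}. of_nat j)"

definition last_visit :: "(nat \<Rightarrow> 'v) \<Rightarrow> 'v \<Rightarrow> nat \<Rightarrow> nat"
  where "last_visit v u n =
    (if \<exists>j\<in>{1..n}. v j = u then Max {j \<in> {1..n}. v j = u} else 1)"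

definition history ::
    "'w measure \<Rightarrow> 'v set \<Rightarrow> (nat \<Rightarrow> 'w \<Rightarrow> 'v) \<Rightarrow> (nat \<Rightarrow> 'w \<Rightarrow> 'a::topological_space) \<Rightarrow> nat \<Rightarrow> 'w measure"
  where "history M V v \<theta> n = sigma (space M)
    ({v i -` A \<inter> space M | i A. i \<in> {1..n} \<and> A \<subseteq> V} \<union>
     {\<theta> i -` B \<inter> space M | i B. i \<in> {0..n} \<and> B \<in> sets borel})"

definition recurrent_sampling ::
    "'w measure \<Rightarrow> 'v set \<Rightarrow> (nat \<Rightarrow> 'w \<Rightarrow> 'v) \<Rightarrow> (nat \<Rightarrow> 'w \<Rightarrow> 'a::topological_space) \<Rightarrow> bool"
  where "recurrent_sampling M V v \<theta> \<longleftrightarrow> (\<forall>u\<in>V.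
    (SUP n\<in>{1..}. esssup M (nn_cond_exp M (history M V v \<theta> n)
       (\<lambda>\<omega>. return_time (\<lambda>i. v i \<omega>) n u))) < \<infinity>)"

subsection \<open>The algorithms, along a single sample path\<close>

text \<open>\<open>v\<close>, \<open>\<theta>\<close> and \<open>g\<close> are the realised samples, iterates and surrogates; \<open>g n u\<close> is the surrogate
  stored at time \<open>n\<close> for the component function \<open>f u\<close>.\<close>

definition dyn_reg :: "'v set \<Rightarrow> real \<Rightarrow> (nat \<Rightarrow> 'v) \<Rightarrow> nat \<Rightarrow> real"
  where "dyn_reg V \<rho> v n = \<rho> + Max ((\<lambda>u. real n - real (last_visit v u n)) ` V)"

definition algorithm1_path ::
    "'v set \<Rightarrow> ('v \<Rightarrow> real) \<Rightarrow> 'a::real_inner set \<Rightarrow> ('v \<Rightarrow> 'a \<Rightarrow> real) \<Rightarrow> real \<Rightarrow> real \<Rightarrow> real \<Rightarrow>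
     (nat \<Rightarrow> 'v) \<Rightarrow> (nat \<Rightarrow> 'a) \<Rightarrow> (nat \<Rightarrow> 'v \<Rightarrow> 'a \<Rightarrow> real) \<Rightarrow> bool"
  where "algorithm1_path V p \<Theta> f L \<rho> \<mu> v \<theta> g \<longleftrightarrow>
    \<theta> 0 \<in> \<Theta> \<and> (\<forall>u\<in>V. g 0 u \<in> strong_surrogates \<Theta> L \<mu> (f u) (\<theta> 0)) \<and>
    (\<forall>n\<ge>1. g n (v n) \<in> strong_surrogates \<Theta> L \<mu> (f (v n)) (\<theta> (n - 1)) \<and>
      (\<forall>u\<in>V - {v n}. g n u = g (n - 1) u) \<and>
      is_arg_min (\<lambda>x. weighted_sum V p (g n) x + dyn_reg V \<rho> v n / 2 * (norm (x - \<theta> (n - 1)))\<^sup>2)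
        (\<lambda>x. x \<in> \<Theta>) (\<theta> n))"

definition algorithm2_path ::
    "'v set \<Rightarrow> ('v \<Rightarrow> real) \<Rightarrow> 'a::real_inner set \<Rightarrow> ('v \<Rightarrow> 'a \<Rightarrow> real) \<Rightarrow> real \<Rightarrow> (nat \<Rightarrow> real) \<Rightarrow>
     (nat \<Rightarrow> 'v) \<Rightarrow> (nat \<Rightarrow> 'a) \<Rightarrow> (nat \<Rightarrow> 'v \<Rightarrow> 'a \<Rightarrow> real) \<Rightarrow> bool"
  where "algorithm2_path V p \<Theta> f L r v \<theta> g \<longleftrightarrow>
    \<theta> 0 \<in> \<Theta> \<and> (\<forall>u\<in>V. g 0 u \<in> surrogates \<Theta> L (f u) (\<theta> 0)) \<and>
    (\<forall>n\<ge>1. g n (v n) \<in> surrogates \<Theta> L (f (v n)) (\<theta> (n - 1)) \<and>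
      (\<forall>u\<in>V - {v n}. g n u = g (n - 1) u) \<and>
      is_arg_min (weighted_sum V p (g n)) (\<lambda>x. x \<in> \<Theta> \<inter> cball (\<theta> (n - 1)) (r n)) (\<theta> n))"

end

theory Submission
  imports Defs
begin

text \<open>Let \<open>D\<^sub>n\<close> be the largest age \<open>n - k\<^sup>v(n)\<close> of a stored surrogate. Recurrence and Markov's inequality show
  that, given the past, a fixed number of steps visits \<open>v\<close> with probability at least \<open>1/2\<close>; iterating this gives
  \<open>D\<^sub>n\<close> a geometric tail that is uniform in \<open>n\<close>. Everything else holds along each sample path, so that the
  surrogates, which need not be measurable, never have to be integrated.

  Since updating a surrogate does not increase the averaged surrogate at the current iterate, the objective
  values telescope. In Algorithm 1 this bounds \<open>\<Sum> \<parallel>\<theta>\<^sub>i - \<theta>\<^sub>i\<^sub>-\<^sub>1\<parallel>\<^sup>2\<close> by a constant, while the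
  first-order condition bounds the optimality gap by \<open>\<rho> + L + D\<^sub>n\<close> times the length of the last \<open>D\<^sub>n + 1\<close> steps;
  the moments of \<open>D\<^sub>n\<close> then yield the limit. In Algorithm 2, comparing with a step of length at most \<open>r\<^sub>n\<close>
  towards an arbitrary point of \<open>\<Theta>\<close> shows that \<open>r\<^sub>n\<close> times the optimality gap is almost surely summable. As
  \<open>r\<^sub>n\<close> also bounds the step length, the iterates could not leave the neighbourhood of a non-stationary
  limit point, which contradicts \<open>\<Sum> r\<^sub>n = \<infinity>\<close>.\<close>

subsection \<open>The tail of the lag\<close>

text \<open>The window excludes time \<open>s\<close>. For \<open>n \<le> s\<close> it is empty and
  the event is the whole space.\<close>

definition avoids :: "'w measure \<Rightarrow> (nat \<Rightarrow> 'w \<Rightarrow> 'v) \<Rightarrow> 'v \<Rightarrow> nat \<Rightarrow> nat \<Rightarrow> 'w set"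
  where "avoids M v u s n = {\<omega> \<in> space M. \<forall>i\<in>{s<..n}. v i \<omega> \<noteq> u}"

lemma return_time_measurable:
  assumes v: "\<And>n. n \<ge> 1 \<Longrightarrow> v n \<in> M \<rightarrow>\<^sub>M count_space V"
  shows "(\<lambda>\<omega>. return_time (\<lambda>i. v i \<omega>) n u) \<in> borel_measurable M"
proof -
  \<comment> \<open>The index set of the infimum depends on the sample. Giving non-visits the value
    \<open>\<top>\<close> turns it into a countable infimum over a fixed set, so that measurability
    can be checked term by term.\<close>
  have "return_time (\<lambda>i. v i \<omega>) n u = (INF j\<in>{1..}. if v (n + j) \<omega> = u then of_nat j else \<top>)" for \<omega>
    unfolding return_time_def
  proof (intro antisym INF_greatest)
    fix j :: nat assume "j \<in> {1..}"
    then show "(INF j\<in>{j. 1 \<le> j \<and> v (n + j) \<omega> = u}. of_nat j)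
      \<le> (if v (n + j) \<omega> = u then of_nat j else (\<top>::ennreal))"
      by (auto intro!: INF_lower)
  next
    fix j :: nat assume "j \<in> {j. 1 \<le> j \<and> v (n + j) \<omega> = u}"
    then show "(INF j\<in>{1..}. if v (n + j) \<omega> = u then of_nat j else (\<top>::ennreal)) \<le> of_nat j"
      by (intro INF_lower2[of j]) auto
  qed
  moreover have "(\<lambda>\<omega>. INF j\<in>{1..}. if v (n + j) \<omega> = u then of_nat j else (\<top>::ennreal)) \<in> borel_measurable M"
  proof (intro borel_measurable_INF)
    fix j :: nat assume "j \<in> {1..}"
    then have [measurable]: "v (n + j) \<in> M \<rightarrow>\<^sub>M count_space V"
      using v by simp
    have [measurable]: "Measurable.pred M (\<lambda>\<omega>. v (n + j) \<omega> = u)"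
      by (rule measurable_compose[of "v (n + j)" M "count_space V" "\<lambda>x. x = u"]) simp_all
    show "(\<lambda>\<omega>. if v (n + j) \<omega> = u then of_nat j else (\<top>::ennreal)) \<in> borel_measurable M"
      by measurable
  qed simp
  ultimately show ?thesis by simp
qed

lemma
  shows space_history: "space (history M V v \<theta> n) = space M"
    and sets_history: "sets (history M V v \<theta> n) = sigma_sets (space M)
      ({v i -` A \<inter> space M | i A. i \<in> {1..n} \<and> A \<subseteq> V} \<union>
       {\<theta> i -` B \<inter> space M | i B. i \<in> {0..n} \<and> B \<in> sets borel})"
  unfolding history_def by (auto intro!: space_measure_of sets_measure_of)

lemma subalgebra_history:
  assumes v: "\<And>n. n \<ge> 1 \<Longrightarrow> v n \<in> M \<rightarrow>\<^sub>M count_space V"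
    and \<theta>: "\<And>n. \<theta> n \<in> borel_measurable M"
  shows "subalgebra M (history M V v \<theta> n)"
  unfolding subalgebra_def sets_history space_history
  by (auto intro!: sets.sigma_sets_subset measurable_sets[OF v] measurable_sets[OF \<theta>])

lemma avoids_in_history:
  assumes v: "\<And>n. n \<ge> 1 \<Longrightarrow> v n \<in> M \<rightarrow>\<^sub>M count_space V"
  shows "avoids M v u s n \<in> sets (history M V v \<theta> n)"
proof -
  \<comment> \<open>The generators of \<open>history\<close> are preimages of subsets of
    \<open>V\<close>, so avoiding \<open>u\<close> is phrased as taking values in
    \<open>V - {u}\<close>.\<close>
  have "avoids M v u s n = {\<omega> \<in> space M. \<forall>i\<in>{s<..n}. v i \<omega> \<in> V - {u}}"
    unfolding avoids_def using measurable_space[OF v] by fastforce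
  also have "\<dots> = {\<omega> \<in> space (history M V v \<theta> n). \<forall>i\<in>{s<..n}. v i \<omega> \<in> V - {u}}"
    by (simp add: space_history)
  also have "\<dots> \<in> sets (history M V v \<theta> n)"
  proof (rule sets.sets_Collect_finite_All)
    fix i assume "i \<in> {s<..n}"
    then have "v i -` (V - {u}) \<inter> space M \<in> sets (history M V v \<theta> n)"
      unfolding sets_history by (intro sigma_sets.Basic UnI1 CollectI exI[of _ i] exI[of _ "V - {u}"]) auto
    also have "v i -` (V - {u}) \<inter> space M = {\<omega> \<in> space (history M V v \<theta> n). v i \<omega> \<in> V - {u}}"
      by (auto simp: space_history)
    finally show "{\<omega> \<in> space (history M V v \<theta> n). v i \<omega> \<in> V - {u}} \<in> sets (history M V v \<theta> n)" .
  qed simp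
  finally show ?thesis .
qed

lemma avoids_measurable:
  assumes v: "\<And>n. n \<ge> 1 \<Longrightarrow> v n \<in> M \<rightarrow>\<^sub>M count_space V"
  shows "avoids M v u s n \<in> sets M"
proof -
  \<comment> \<open>The event depends on the samples alone, so a constant process can stand in for
    the iterates.\<close>
  let ?F = "history M V v (\<lambda>_ _. 0 :: real) n"
  have "subalgebra M ?F"
    by (rule subalgebra_history[OF v]) simp_all
  moreover have "avoids M v u s n \<in> sets ?F"
    by (rule avoids_in_history[OF v])
  ultimately show ?thesis
    by (auto simp: subalgebra_def)
qed

text \<open>Markov's inequality given the past: avoiding \<open>u\<close> up to time
  \<open>n + m\<close> forces a return time above \<open>m\<close>. Whether \<open>u\<close> was
  avoided up to time \<open>n\<close> is known at time \<open>n\<close>, so the conditional bound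
  \<open>C\<close> may be used on that event.\<close>

lemma emeasure_avoids_add:
  assumes M: "prob_space M"
    and v: "\<And>n. n \<ge> 1 \<Longrightarrow> v n \<in> M \<rightarrow>\<^sub>M count_space V"
    and \<theta>: "\<And>n. \<theta> n \<in> borel_measurable M"
    and "s \<le> n"
    and C: "AE \<omega> in M. nn_cond_exp M (history M V v \<theta> n)
       (\<lambda>\<omega>. return_time (\<lambda>i. v i \<omega>) n u) \<omega> \<le> C"
  shows "of_nat m * emeasure M (avoids M v u s (n + m)) \<le> C * emeasure M (avoids M v u s n)"
proof -
  let ?F = "history M V v \<theta> n" and ?\<tau> = "\<lambda>\<omega>. return_time (\<lambda>i. v i \<omega>) n u"
  interpret prob_space M by (rule M)
  interpret finite_measure_subalgebra M ?F
    by unfold_locales (rule subalgebra_history[OF v \<theta>])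
  have [measurable]: "avoids M v u s k \<in> sets M" for k
    by (rule avoids_measurable[OF v])
  have [measurable]: "?\<tau> \<in> borel_measurable M"
    by (rule return_time_measurable[OF v])
  have [measurable]: "avoids M v u s n \<in> sets ?F"
    by (rule avoids_in_history[OF v])
  have "of_nat m * emeasure M (avoids M v u s (n + m))
    = (\<integral>\<^sup>+\<omega>. of_nat m * indicator (avoids M v u s (n + m)) \<omega> \<partial>M)"
    by (simp add: nn_integral_cmult)
  also have "\<dots> \<le> (\<integral>\<^sup>+\<omega>. indicator (avoids M v u s n) \<omega> * ?\<tau> \<omega> \<partial>M)"
  proof (intro nn_integral_mono)
    fix \<omega>
    have "of_nat m \<le> ?\<tau> \<omega>" if \<omega>: "\<omega> \<in> avoids M v u s (n + m)"
      unfolding return_time_def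
    proof (intro INF_greatest)
      fix j assume j: "j \<in> {j. 1 \<le> j \<and> v (n + j) \<omega> = u}"
      show "(of_nat m :: ennreal) \<le> of_nat j"
      proof (cases "n + j \<in> {s<..n+m}")
        case True
        then show ?thesis using \<omega> j by (auto simp: avoids_def)
      next
        case False
        then show ?thesis using j \<open>s \<le> n\<close> by simp
      qed
    qed
    then show "of_nat m * indicator (avoids M v u s (n + m)) \<omega>
      \<le> indicator (avoids M v u s n) \<omega> * ?\<tau> \<omega>"
      by (auto simp: avoids_def split: split_indicator)
  qed
  also have "\<dots> = (\<integral>\<^sup>+\<omega>. indicator (avoids M v u s n) \<omega> * nn_cond_exp M ?F ?\<tau> \<omega> \<partial>M)"
    by (rule nn_cond_exp_intg[symmetric]) measurable
  also have "\<dots> \<le> (\<integral>\<^sup>+\<omega>. C * indicator (avoids M v u s n) \<omega> \<partial>M)"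
    using C by (intro nn_integral_mono_AE) (auto split: split_indicator)
  also have "\<dots> = C * emeasure M (avoids M v u s n)"
    by (simp add: nn_integral_cmult)
  finally show ?thesis .
qed

section \<open>Last visits and the maximal lag\<close>

lemma last_visit_0 [simp]: "last_visit v u 0 = 1"
  by (simp add: last_visit_def)

lemma last_visit_upper: "j \<in> {1..n} \<Longrightarrow> v j = u \<Longrightarrow> j \<le> last_visit v u n"
  unfolding last_visit_def by (auto intro!: Max_ge)

text \<open>This recursion replaces the \<open>Max\<close> of the definition; bounds, measurability
  and the anchors of stored surrogates follow from it by induction on time.\<close>

lemma last_visit_Suc:
  "last_visit v u (Suc n) = (if v (Suc n) = u then Suc n else last_visit v u n)"
proof (cases "v (Suc n) = u")
  case True
  then show ?thesis
    by (auto simp: last_visit_def intro!: Max_eqI)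
next
  case False
  then have "{j \<in> {1..Suc n}. v j = u} = {j \<in> {1..n}. v j = u}"
    by (auto simp: le_Suc_eq)
  moreover from this have "(\<exists>j\<in>{1..Suc n}. v j = u) \<longleftrightarrow> (\<exists>j\<in>{1..n}. v j = u)"
    by blast
  ultimately show ?thesis
    using False by (simp add: last_visit_def)
qed

lemma last_visit_ge_1: "1 \<le> last_visit v u n"
  by (induction n) (simp_all add: last_visit_Suc)

text \<open>Time 0 is excluded because the default value 1 exceeds it.\<close>

lemma last_visit_le: "1 \<le> n \<Longrightarrow> last_visit v u n \<le> n"
  by (induction n rule: dec_induct) (auto simp: last_visit_Suc)

text \<open>Natural-number form of the maximum in \<open>dyn_reg\<close>. For
  \<open>n \<ge> 1\<close> the subtraction is exact by \<open>last_visit_le\<close>; at time 0 it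
  truncates to 0.\<close>

definition max_lag :: "'v set \<Rightarrow> (nat \<Rightarrow> 'v) \<Rightarrow> nat \<Rightarrow> nat"
  where "max_lag V v n = Max ((\<lambda>u. n - last_visit v u n) ` V)"

lemma lag_le_max_lag: "finite V \<Longrightarrow> u \<in> V \<Longrightarrow> n - last_visit v u n \<le> max_lag V v n"
  by (simp add: max_lag_def)

lemma max_lag_iff:
  "finite V \<Longrightarrow> V \<noteq> {} \<Longrightarrow> j \<le> max_lag V v n \<longleftrightarrow> (\<exists>u\<in>V. j \<le> n - last_visit v u n)"
  by (simp add: max_lag_def Max_ge_iff)

lemma last_visit_measurable:
  assumes v: "\<And>n. n \<ge> 1 \<Longrightarrow> v n \<in> M \<rightarrow>\<^sub>M count_space V"
  shows "(\<lambda>\<omega>. last_visit (\<lambda>i. v i \<omega>) u n) \<in> M \<rightarrow>\<^sub>M count_space UNIV"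
proof (induction n)
  case (Suc n)
  note Suc [measurable]
  have [measurable]: "v (Suc n) \<in> M \<rightarrow>\<^sub>M count_space V"
    using v by simp
  have [measurable]: "Measurable.pred M (\<lambda>\<omega>. v (Suc n) \<omega> = u)"
    by (rule measurable_compose[of "v (Suc n)" M "count_space V" "\<lambda>x. x = u"]) simp_all
  show ?case
    unfolding last_visit_Suc by measurable
qed simp

lemma max_lag_measurable:
  assumes V: "finite V" "V \<noteq> {}"
    and v: "\<And>n. n \<ge> 1 \<Longrightarrow> v n \<in> M \<rightarrow>\<^sub>M count_space V"
  shows "(\<lambda>\<omega>. max_lag V (\<lambda>i. v i \<omega>) n) \<in> M \<rightarrow>\<^sub>M count_space UNIV"
proof -
  have [measurable]: "(\<lambda>\<omega>. last_visit (\<lambda>i. v i \<omega>) u n) \<in> M \<rightarrow>\<^sub>M count_space UNIV" for u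
    by (rule last_visit_measurable[OF v])
  have "{\<omega> \<in> space M. j \<le> max_lag V (\<lambda>i. v i \<omega>) n} \<in> sets M" for j
    unfolding max_lag_iff[OF V] using V(1) by measurable
  then have [measurable]: "Measurable.pred M (\<lambda>\<omega>. j \<le> max_lag V (\<lambda>i. v i \<omega>) n)" for j
    by (simp add: pred_def)
  \<comment> \<open>Level sets are differences of consecutive upper level sets, which are finite
    unions over \<open>V\<close>.\<close>
  have eq: "max_lag V (\<lambda>i. v i \<omega>) n = j \<longleftrightarrow>
    j \<le> max_lag V (\<lambda>i. v i \<omega>) n \<and> \<not> Suc j \<le> max_lag V (\<lambda>i. v i \<omega>) n" for \<omega> j
    by auto
  have "Measurable.pred M (\<lambda>\<omega>. max_lag V (\<lambda>i. v i \<omega>) n = j)" for j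
    unfolding eq by measurable
  then show ?thesis
    by (intro measurable_count_space_eq_countable[THEN iffD2] conjI ballI)
      (auto simp: pred_def vimage_def Int_def conj_commute)
qed

text \<open>Iterates \<open>emeasure_avoids_add\<close> over blocks of equal length. The supremum in
  \<open>recurrent_sampling\<close> makes the block length independent of the starting time
  \<open>s\<close>; it runs over times from 1 on, hence \<open>s \<ge> 1\<close>.\<close>

lemma emeasure_avoids_geometric:
  assumes M: "prob_space M"
    and v: "\<And>n. n \<ge> 1 \<Longrightarrow> v n \<in> M \<rightarrow>\<^sub>M count_space V"
    and \<theta>: "\<And>n. \<theta> n \<in> borel_measurable M"
    and rec: "recurrent_sampling M V v \<theta>" and u: "u \<in> V"
  shows "\<exists>m\<ge>1. \<forall>s\<ge>1. \<forall>j. emeasure M (avoids M v u s (s + j * m)) \<le> ennreal ((1/2) ^ j)"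
proof -
  let ?E = "\<lambda>n. nn_cond_exp M (history M V v \<theta> n) (\<lambda>\<omega>. return_time (\<lambda>i. v i \<omega>) n u)"
  interpret prob_space M by (rule M)
  define C where "C = (SUP n\<in>{1..}. esssup M (?E n))"
  have "C < \<infinity>"
    using rec u unfolding recurrent_sampling_def C_def by blast
  then obtain c where c: "0 \<le> c" "C = ennreal c"
    by (cases C) auto
  have C: "AE \<omega> in M. ?E n \<omega> \<le> C" if "n \<ge> 1" for n
  proof -
    have "esssup M (?E n) \<le> C"
      unfolding C_def using that by (intro SUP_upper) simp
    then show ?thesis
      using esssup_AE[of "?E n" M] by (auto elim: eventually_mono order_trans)
  qed
  \<comment> \<open>Blocks of length at least \<open>2 * c\<close> make the Markov factor
    \<open>c / m\<close> at most \<open>1/2\<close>; the summand 1 keeps \<open>m\<close> positive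
    when \<open>c = 0\<close>.\<close>
  define m where "m = nat \<lceil>2 * c\<rceil> + 1"
  have m: "2 * c \<le> real m" "1 \<le> m"
    unfolding m_def by linarith+
  have "emeasure M (avoids M v u s (s + j * m)) \<le> ennreal ((1/2) ^ j)" if s: "s \<ge> 1" for s j
  proof (induction j)
    case 0
    then show ?case by (simp add: emeasure_le_1)
  next
    case (Suc j)
    let ?a = "\<lambda>j. measure M (avoids M v u s (s + j * m))"
    have "real m * ?a (Suc j) \<le> c * ?a j"
    proof -
      have "of_nat m * emeasure M (avoids M v u s (s + j * m + m))
        \<le> C * emeasure M (avoids M v u s (s + j * m))"
        by (rule emeasure_avoids_add[OF M v \<theta> _ C]) (use s in auto)
      then have "ennreal (real m * measure M (avoids M v u s (s + j * m + m)))
        \<le> ennreal (c * ?a j)"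
        using c by (simp add: emeasure_eq_measure ennreal_mult ennreal_of_nat_eq_real_of_nat)
      then show ?thesis
        using c by (simp add: ennreal_le_iff algebra_simps)
    qed
    also have "\<dots> \<le> real m / 2 * ?a j"
      using m by (intro mult_right_mono) auto
    finally have "real m * ?a (Suc j) \<le> real m * (?a j / 2)"
      by simp
    then have "?a (Suc j) \<le> ?a j / 2"
      using m by (subst (asm) mult_le_cancel_left_pos) auto
    also have "?a j \<le> (1/2) ^ j"
      using Suc by (simp add: emeasure_eq_measure ennreal_le_iff)
    finally show ?case
      by (simp add: emeasure_eq_measure ennreal_le_iff)
  qed
  then show ?thesis
    using m by blast
qed

text \<open>Converts halving once per block of \<open>m\<close> steps into decay at every step, with
  rate the \<open>m\<close>-th root of \<open>1/2\<close>. The factor 2 pays for the incomplete last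
  block.\<close>

lemma half_power_div_le:
  assumes "1 \<le> m"
  shows "\<exists>q. 0 < q \<and> q < 1 \<and> (\<forall>j. (1/2 :: real) ^ (j div m) \<le> 2 * q ^ j)"
proof (intro exI[of _ "root m (1/2)"] conjI allI)
  let ?q = "root m (1/2)"
  show q: "0 < ?q" "?q < 1"
    using assms by auto
  fix j
  have "(1/2) ^ (j div m) = 2 * (?q ^ m * (?q ^ m) ^ (j div m))"
    using assms by simp
  also have "\<dots> \<le> 2 * (?q ^ (j mod m) * (?q ^ m) ^ (j div m))"
    using q assms by (intro mult_left_mono mult_right_mono power_decreasing) auto
  also have "\<dots> = 2 * ?q ^ j"
    by (simp add: power_add[symmetric] power_mult[symmetric])
  finally show "(1/2) ^ (j div m) \<le> 2 * ?q ^ j" .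
qed

text \<open>A lag of at least \<open>j\<close> for \<open>u\<close> means that \<open>u\<close> was
  missed at the last \<open>j\<close> times. The block estimate makes this unlikely, and a union
  bound over \<open>V\<close> contributes the factor \<open>card V\<close>.\<close>

lemma max_lag_tail:
  assumes M: "prob_space M"
    and V: "finite V" "V \<noteq> {}"
    and v: "\<And>n. n \<ge> 1 \<Longrightarrow> v n \<in> M \<rightarrow>\<^sub>M count_space V"
    and \<theta>: "\<And>n. \<theta> n \<in> borel_measurable M"
    and rec: "recurrent_sampling M V v \<theta>"
  shows "\<exists>c q. 0 < c \<and> 0 < q \<and> q < 1 \<and>
    (\<forall>n j. emeasure M {\<omega> \<in> space M. j \<le> max_lag V (\<lambda>i. v i \<omega>) n} \<le> ennreal (c * q ^ j))"
proof -
  interpret prob_space M by (rule M)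
  obtain m where m: "\<And>u. u \<in> V \<Longrightarrow> 1 \<le> m u"
    and av: "\<And>u s j. u \<in> V \<Longrightarrow> 1 \<le> s \<Longrightarrow>
      emeasure M (avoids M v u s (s + j * m u)) \<le> ennreal ((1/2) ^ j)"
    using emeasure_avoids_geometric[OF M v \<theta> rec] by metis
  obtain q where q: "\<And>u. u \<in> V \<Longrightarrow> 0 < q u" "\<And>u. u \<in> V \<Longrightarrow> q u < (1::real)"
    "\<And>u j. u \<in> V \<Longrightarrow> (1/2) ^ (j div m u) \<le> 2 * q u ^ j"
    using half_power_div_le[OF m] by metis
  \<comment> \<open>The slowest of the finitely many rates serves every \<open>u\<close>.\<close>
  define Q where "Q = Max (q ` V)"
  have Q: "0 < Q" "Q < 1" and qQ: "\<And>u. u \<in> V \<Longrightarrow> q u \<le> Q"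
    using V q(1,2) by (auto simp: Q_def Max_gr_iff)
  have avm: "avoids M v u s n \<in> sets M" for u s n
    by (rule avoids_measurable[OF v])
  have lag: "emeasure M {\<omega> \<in> space M. j \<le> n - last_visit (\<lambda>i. v i \<omega>) u n} \<le> ennreal (2 * Q ^ j)"
    if u: "u \<in> V" for u n j
  \<comment> \<open>For \<open>j = 0\<close> the bound is 2; for \<open>0 < j\<close> and
    \<open>n \<le> j\<close> the event is empty, since last visits are at least 1. Otherwise the
    avoidance window starts at \<open>n - j \<ge> 1\<close>, as \<open>av\<close> requires.\<close>
  proof (cases "j = 0 \<or> n \<le> j")
    case True
    show ?thesis
    proof (cases "j = 0")
      case True
      have "emeasure M (space M) = ennreal 1"
        by (simp add: emeasure_space_1)
      also have "\<dots> \<le> ennreal (2 * Q ^ j)"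
        using True by (intro ennreal_leI) simp
      finally show ?thesis using True by simp
    next
      case False
      then have "\<not> j \<le> n - last_visit (\<lambda>i. v i \<omega>) u n" for \<omega>
        using True last_visit_ge_1[where v = "\<lambda>i. v i \<omega>" and u = u and n = n] by linarith
      then show ?thesis by simp
    qed
  next
    case False
    \<comment> \<open>The window of the last \<open>j\<close> times is shortened to a whole number
      of blocks.\<close>
    have "{\<omega> \<in> space M. j \<le> n - last_visit (\<lambda>i. v i \<omega>) u n}
      \<subseteq> avoids M v u (n - j) (n - j + (j div m u) * m u)"
    proof
      fix \<omega> assume \<omega>: "\<omega> \<in> {\<omega> \<in> space M. j \<le> n - last_visit (\<lambda>i. v i \<omega>) u n}"
      have "v i \<omega> \<noteq> u" if i: "i \<in> {n - j<..n - j + (j div m u) * m u}" for i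
      proof
        assume vi: "v i \<omega> = u"
        have "(j div m u) * m u \<le> j" by (rule div_times_less_eq_dividend)
        moreover have "n - j < i" "i \<le> n - j + (j div m u) * m u" using i by auto
        ultimately have "i \<le> n" "n - j < i" using False by linarith+
        then show False
          using last_visit_upper[where j = i and n = n and v = "\<lambda>i. v i \<omega>" and u = u] vi \<omega> by auto
      qed
      then show "\<omega> \<in> avoids M v u (n - j) (n - j + (j div m u) * m u)"
        using \<omega> by (auto simp: avoids_def)
    qed
    then have "emeasure M {\<omega> \<in> space M. j \<le> n - last_visit (\<lambda>i. v i \<omega>) u n}
      \<le> emeasure M (avoids M v u (n - j) (n - j + (j div m u) * m u))"
      by (rule emeasure_mono[OF _ avm])
    also have "\<dots> \<le> ennreal ((1/2) ^ (j div m u))"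
      using False by (intro av[OF u]) linarith
    also have "\<dots> \<le> ennreal (2 * Q ^ j)"
    proof (intro ennreal_leI order_trans[OF q(3)[OF u]] mult_left_mono power_mono qQ u)
      show "0 \<le> q u" using q(1)[OF u] by simp
    qed simp
    finally show ?thesis .
  qed
  have "emeasure M {\<omega> \<in> space M. j \<le> max_lag V (\<lambda>i. v i \<omega>) n} \<le> ennreal (2 * card V * Q ^ j)"
    for n j
  proof -
    have "{\<omega> \<in> space M. j \<le> max_lag V (\<lambda>i. v i \<omega>) n}
      = (\<Union>u\<in>V. {\<omega> \<in> space M. j \<le> n - last_visit (\<lambda>i. v i \<omega>) u n})"
      by (auto simp: max_lag_iff[OF V])
    also have "emeasure M \<dots> \<le> (\<Sum>u\<in>V. emeasure M {\<omega> \<in> space M. j \<le> n - last_visit (\<lambda>i. v i \<omega>) u n})"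
    proof (intro emeasure_subadditive_finite V image_subsetI)
      fix u
      note last_visit_measurable[OF v, measurable]
      show "{\<omega> \<in> space M. j \<le> n - last_visit (\<lambda>i. v i \<omega>) u n} \<in> sets M"
        by measurable
    qed
    also have "\<dots> \<le> (\<Sum>u\<in>V. ennreal (2 * Q ^ j))"
      by (intro sum_mono lag)
    also have "\<dots> = ennreal (2 * card V * Q ^ j)"
      using Q by (subst sum_ennreal) (auto simp: mult_ac)
    finally show ?thesis .
  qed
  then show ?thesis
    using Q V by (intro exI[of _ "2 * real (card V)"] exI[of _ Q]) (simp add: card_gt_0_iff)
qed

subsection \<open>Directional derivatives and surrogates\<close>

lemma GDERIV_along_line:
  assumes "GDERIV h (x + t *\<^sub>R d) :> w"
  shows "((\<lambda>t. h (x + t *\<^sub>R d)) has_real_derivative inner w d) (at t)"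
proof -
  have "((\<lambda>t. x + t *\<^sub>R d) has_derivative (\<lambda>s. s *\<^sub>R d)) (at t)"
    by (auto intro!: derivative_eq_intros)
  from has_derivative_compose[OF this assms[unfolded gderiv_def]]
  have "((\<lambda>t. h (x + t *\<^sub>R d)) has_derivative (\<lambda>s. inner (s *\<^sub>R d) w)) (at t)" .
  moreover have "(\<lambda>s. inner (s *\<^sub>R d) w) = (*) (inner w d)"
    by (simp add: fun_eq_iff inner_commute)
  ultimately show ?thesis
    by (simp add: has_field_derivative_def)
qed

lemma GDERIV_tendsto_dir_quotient:
  assumes "GDERIV h x :> w"
  shows "(dir_quotient h x d \<longlongrightarrow> inner w d) (at_right 0)"
proof -
  have "((\<lambda>t. h (x + t *\<^sub>R d)) has_real_derivative inner w d) (at 0)"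
    using assms by (intro GDERIV_along_line) simp
  then have "((\<lambda>t. (h (x + t *\<^sub>R d) - h x) / t) \<longlongrightarrow> inner w d) (at 0)"
    by (simp add: DERIV_def)
  then show ?thesis
    unfolding dir_quotient_def by (rule filterlim_mono) (simp_all add: at_le)
qed

lemma dir_deriv_eq: "(dir_quotient f x d \<longlongrightarrow> l) (at_right 0) \<Longrightarrow> dir_deriv f x d = l"
  unfolding dir_deriv_def by (intro tendsto_Lim) simp_all

lemma dir_deriv_tendsto:
  assumes "has_dir_deriv f x d"
  shows "(dir_quotient f x d \<longlongrightarrow> dir_deriv f x d) (at_right 0)"
  using assms dir_deriv_eq unfolding has_dir_deriv_def by blast

lemma dir_deriv_GDERIV: "GDERIV f x :> w \<Longrightarrow> dir_deriv f x d = inner w d"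
  by (intro dir_deriv_eq GDERIV_tendsto_dir_quotient)

lemma has_dir_deriv_weighted_sum:
  assumes "\<And>u. u \<in> V \<Longrightarrow> has_dir_deriv (f u) x d"
  shows "has_dir_deriv (weighted_sum V p f) x d"
proof -
  have "dir_quotient (weighted_sum V p f) x d = (\<lambda>\<alpha>. \<Sum>u\<in>V. p u * dir_quotient (f u) x d \<alpha>)"
    by (simp add: dir_quotient_def weighted_sum_def fun_eq_iff diff_divide_distrib
        sum_divide_distrib right_diff_distrib sum_subtractf)
  moreover have "((\<lambda>\<alpha>. \<Sum>u\<in>V. p u * dir_quotient (f u) x d \<alpha>)
    \<longlongrightarrow> (\<Sum>u\<in>V. p u * dir_deriv (f u) x d)) (at_right 0)"
    by (intro tendsto_sum tendsto_mult tendsto_const dir_deriv_tendsto assms)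
  ultimately show ?thesis
    unfolding has_dir_deriv_def by auto
qed

lemma opt_gap_nonneg:
  assumes "x \<in> \<Theta>"
  shows "0 \<le> opt_gap \<Theta> f x"
proof -
  have "dir_deriv f x 0 = 0"
    by (intro dir_deriv_eq) (simp add: dir_quotient_def)
  then show ?thesis
    unfolding opt_gap_def using assms by (intro SUP_upper2[of x]) auto
qed

text \<open>First-order optimality in which \<open>f\<close> enters only through directional
  derivatives: towards points of \<open>\<Theta>\<close> the derivative of \<open>f + h\<close> is
  nonnegative, so \<open>- dir_deriv f x (y - x)\<close> is at most \<open>inner w (y - x)\<close>,
  and Cauchy-Schwarz applies.\<close>

lemma opt_gap_minimizer_le:
  assumes \<Theta>: "convex \<Theta>" "x \<in> \<Theta>"
    and dir: "\<And>y. y \<in> \<Theta> \<Longrightarrow> has_dir_deriv f x (y - x)"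
    and h: "GDERIV h x :> w"
    and min: "\<And>y. y \<in> \<Theta> \<Longrightarrow> f x + h x \<le> f y + h y"
  shows "opt_gap \<Theta> f x \<le> ereal (norm w)"
  unfolding opt_gap_def
proof (intro SUP_least)
  fix y assume "y \<in> {y \<in> \<Theta>. norm (y - x) \<le> 1}"
  then have y: "y \<in> \<Theta>" "norm (y - x) \<le> 1" by auto
  let ?d = "y - x"
  have lim: "((\<lambda>\<alpha>. dir_quotient f x ?d \<alpha> + dir_quotient h x ?d \<alpha>)
    \<longlongrightarrow> dir_deriv f x ?d + inner w ?d) (at_right 0)"
    by (intro tendsto_add dir_deriv_tendsto GDERIV_tendsto_dir_quotient dir y h)
  have "\<forall>\<^sub>F \<alpha> in at_right (0::real). \<alpha> \<in> {0<..<1}"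
    by (intro eventually_at_right_real) simp
  then have "\<forall>\<^sub>F \<alpha> in at_right 0. 0 \<le> dir_quotient f x ?d \<alpha> + dir_quotient h x ?d \<alpha>"
  proof eventually_elim
    case (elim \<alpha>)
    have "x + \<alpha> *\<^sub>R ?d = (1 - \<alpha>) *\<^sub>R x + \<alpha> *\<^sub>R y"
      by (simp add: algebra_simps)
    also have "\<dots> \<in> \<Theta>"
      using elim by (intro convexD[OF \<Theta>(1)] \<Theta> y) auto
    finally have "f x + h x \<le> f (x + \<alpha> *\<^sub>R ?d) + h (x + \<alpha> *\<^sub>R ?d)"
      by (rule min)
    then show ?case
      using elim by (simp add: dir_quotient_def add_divide_distrib[symmetric])
  qed
  then have "0 \<le> dir_deriv f x ?d + inner w ?d"
    by (intro tendsto_lowerbound[OF lim]) simp_all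
  moreover have "inner w ?d \<le> norm w * 1"
    using y(2) by (intro order_trans[OF norm_cauchy_schwarz] mult_left_mono) auto
  ultimately show "ereal (- dir_deriv f x ?d) \<le> ereal (norm w)"
    by simp
qed

section \<open>Gradients and the gap between surrogates and objective\<close>

lemma GDERIV_half_norm_square:
  "GDERIV (\<lambda>x. c / 2 * (norm (x - a))\<^sup>2) x :> c *\<^sub>R (x - a)"
  unfolding gderiv_def power2_norm_eq_inner
  by (auto intro!: derivative_eq_intros simp: inner_commute algebra_simps)

lemma GDERIV_unique:
  assumes "GDERIV h x :> w" "GDERIV h x :> w'"
  shows "w = w'"
  using has_derivative_unique[OF assms[unfolded gderiv_def]]
  by (metis inner_commute vector_eq_rdot)

lemma GDERIV_weighted_sum:
  assumes "\<And>u. u \<in> V \<Longrightarrow> GDERIV (h u) x :> G u"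
  shows "GDERIV (weighted_sum V p h) x :> (\<Sum>u\<in>V. p u *\<^sub>R G u)"
  using assms unfolding gderiv_def weighted_sum_def
  by (auto intro!: derivative_eq_intros simp: inner_sum_right sum_distrib_left fun_eq_iff)

text \<open>The descent lemma. The mean value theorem on the segment, in place of integration, gives
  the constant \<open>L\<close> instead of \<open>L / 2\<close>, which affects only later
  constants.\<close>

lemma lipschitz_gradient_upper_bound:
  assumes G: "\<And>x. GDERIV h x :> G x" and L: "L-lipschitz_on UNIV G"
  shows "h (x + d) \<le> h x + inner (G x) d + L * (norm d)\<^sup>2"
proof -
  have "((\<lambda>t. h (x + t *\<^sub>R d)) has_real_derivative inner (G (x + t *\<^sub>R d)) d) (at t)" for t
    by (intro GDERIV_along_line G)
  from MVT2[OF zero_less_one this]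
  obtain \<xi> :: real where \<xi>: "0 < \<xi>" "\<xi> < 1" "h (x + d) - h x = inner (G (x + \<xi> *\<^sub>R d)) d"
    by auto
  have "h (x + d) - h x - inner (G x) d = inner (G (x + \<xi> *\<^sub>R d) - G x) d"
    by (simp add: \<xi> inner_diff_left)
  also have "\<dots> \<le> norm (G (x + \<xi> *\<^sub>R d) - G x) * norm d"
    by (rule norm_cauchy_schwarz)
  also have "\<dots> \<le> L * norm d * norm d"
  proof (intro mult_right_mono)
    have "norm (G (x + \<xi> *\<^sub>R d) - G x) \<le> L * norm (\<xi> *\<^sub>R d)"
      using lipschitz_onD[OF L, of "x + \<xi> *\<^sub>R d" x] by (simp add: dist_norm)
    also have "\<dots> \<le> L * norm d"
      using \<xi> lipschitz_on_nonneg[OF L] by (intro mult_left_mono) (auto intro: mult_left_le_one_le)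
    finally show "norm (G (x + \<xi> *\<^sub>R d) - G x) \<le> L * norm d" .
  qed simp
  finally show ?thesis
    by (simp add: power2_eq_square algebra_simps)
qed

lemma lipschitz_weighted_sum:
  fixes G :: "'v \<Rightarrow> 'a::real_normed_vector \<Rightarrow> 'b::real_normed_vector"
  assumes p: "\<And>u. u \<in> V \<Longrightarrow> 0 \<le> p u" "(\<Sum>u\<in>V. p u) = 1"
    and G: "\<And>u. u \<in> V \<Longrightarrow> L-lipschitz_on UNIV (G u)" and L: "0 \<le> L"
  shows "L-lipschitz_on UNIV (\<lambda>x. \<Sum>u\<in>V. p u *\<^sub>R G u x)"
proof (rule lipschitz_onI)
  fix x y
  have "dist (\<Sum>u\<in>V. p u *\<^sub>R G u x) (\<Sum>u\<in>V. p u *\<^sub>R G u y) = norm (\<Sum>u\<in>V. p u *\<^sub>R (G u x - G u y))"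
    by (simp add: dist_norm sum_subtractf scaleR_diff_right)
  also have "\<dots> \<le> (\<Sum>u\<in>V. p u * (L * dist x y))"
    using p lipschitz_onD[OF G] by (intro sum_norm_le) (auto simp: dist_norm intro!: mult_left_mono)
  also have "\<dots> = L * dist x y"
    by (simp add: p flip: sum_distrib_right)
  finally show "dist (\<Sum>u\<in>V. p u *\<^sub>R G u x) (\<Sum>u\<in>V. p u *\<^sub>R G u y) \<le> L * dist x y" .
qed (rule L)

text \<open>Each gap \<open>g u - f u\<close> is smooth even where \<open>f u\<close> is not, and
  its gradient vanishes at the anchor \<open>t u\<close>. Averaging therefore bounds the gradient at
  \<open>x\<close> by the mean distance to the anchors.\<close>

lemma surrogate_gap_gradient:
  assumes L: "0 \<le> L" and p: "\<And>u. u \<in> V \<Longrightarrow> 0 \<le> p u" "(\<Sum>u\<in>V. p u) = 1"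
    and g: "\<And>u. u \<in> V \<Longrightarrow> g u \<in> surrogates \<Theta> L (f u) (t u)"
  obtains G where "\<And>x. GDERIV (\<lambda>x. weighted_sum V p g x - weighted_sum V p f x) x :> G x"
    and "L-lipschitz_on UNIV G" and "\<And>x. norm (G x) \<le> L * (\<Sum>u\<in>V. p u * norm (x - t u))"
proof -
  \<comment> \<open>The Lipschitz gradient field and the zero gradient at the anchor are given
    separately; uniqueness of gradients identifies them at \<open>t u\<close>.\<close>
  have "\<forall>u\<in>V. \<exists>H. (\<forall>x. GDERIV (\<lambda>x. g u x - f u x) x :> H x) \<and> L-lipschitz_on UNIV H \<and> H (t u) = 0"
    using g unfolding surrogates_def lipschitz_gradient_def by (blast intro: GDERIV_unique)
  then obtain H where H: "\<And>u x. u \<in> V \<Longrightarrow> GDERIV (\<lambda>x. g u x - f u x) x :> H u x"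
    "\<And>u. u \<in> V \<Longrightarrow> L-lipschitz_on UNIV (H u)" "\<And>u. u \<in> V \<Longrightarrow> H u (t u) = 0"
    by metis
  show ?thesis
  proof
    fix x
    have "GDERIV (weighted_sum V p (\<lambda>u x. g u x - f u x)) x :> (\<Sum>u\<in>V. p u *\<^sub>R H u x)"
      by (intro GDERIV_weighted_sum H)
    moreover have "weighted_sum V p (\<lambda>u x. g u x - f u x)
      = (\<lambda>x. weighted_sum V p g x - weighted_sum V p f x)"
      by (simp add: weighted_sum_def right_diff_distrib sum_subtractf)
    ultimately show "GDERIV (\<lambda>x. weighted_sum V p g x - weighted_sum V p f x) x :> (\<Sum>u\<in>V. p u *\<^sub>R H u x)"
      by simp
    have "norm (H u x) \<le> L * norm (x - t u)" if "u \<in> V" for u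
      using lipschitz_onD[OF H(2)[OF that], of x "t u"] H(3)[OF that] by (simp add: dist_norm)
    then have "norm (\<Sum>u\<in>V. p u *\<^sub>R H u x) \<le> (\<Sum>u\<in>V. p u * (L * norm (x - t u)))"
      using p by (intro sum_norm_le) (auto intro: mult_left_mono)
    then show "norm (\<Sum>u\<in>V. p u *\<^sub>R H u x) \<le> L * (\<Sum>u\<in>V. p u * norm (x - t u))"
      by (simp add: sum_distrib_left mult_ac)
  qed (intro lipschitz_weighted_sum p H L)
qed

text \<open>The indices are shifted to match the anchors: a surrogate refreshed at time
  \<open>k\<close> is anchored at the iterate of time \<open>k - 1\<close>.\<close>

lemma norm_diff_le_sum_steps:
  fixes x :: "nat \<Rightarrow> 'a::real_normed_vector"
  assumes "1 \<le> k" "k \<le> n"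
  shows "norm (x (n - 1) - x (k - 1)) \<le> (\<Sum>i\<in>{k..<n}. norm (x i - x (i - 1)))"
  using assms(2)
proof (induction n rule: dec_induct)
  case (step n)
  have "norm (x n - x (k - 1)) \<le> norm (x n - x (n - 1)) + norm (x (n - 1) - x (k - 1))"
    using norm_triangle_ineq[of "x n - x (n - 1)" "x (n - 1) - x (k - 1)"] by simp
  with step show ?case by simp
qed simp

text \<open>Convexity of \<open>g\<close> minus its quadratic part, combined with the parallelogram
  law for the norm.\<close>

lemma strongly_convex_midpoint:
  assumes "strongly_convex \<mu> g"
  shows "g (midpoint x y) \<le> (g x + g y) / 2 - \<mu> / 8 * (norm (x - y))\<^sup>2"
proof -
  have "midpoint x y = (1 - 1 / 2) *\<^sub>R x + (1 / 2) *\<^sub>R y"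
    by (simp add: midpoint_def scaleR_add_right)
  moreover have "g ((1 - 1 / 2) *\<^sub>R x + (1 / 2) *\<^sub>R y) - \<mu> / 2 * (norm ((1 - 1 / 2) *\<^sub>R x + (1 / 2) *\<^sub>R y))\<^sup>2
    \<le> (1 - 1 / 2) * (g x - \<mu> / 2 * (norm x)\<^sup>2) + 1 / 2 * (g y - \<mu> / 2 * (norm y)\<^sup>2)"
    using assms unfolding strongly_convex_def by (intro convex_onD) auto
  ultimately have *: "g (midpoint x y) \<le> (g x + g y) / 2
    - \<mu> / 2 * (((norm x)\<^sup>2 + (norm y)\<^sup>2) / 2 - (norm (midpoint x y))\<^sup>2)"
    by (simp add: field_simps)
  have "((norm x)\<^sup>2 + (norm y)\<^sup>2) / 2 - (norm (midpoint x y))\<^sup>2 = (norm (x - y))\<^sup>2 / 4"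
    unfolding power2_norm_eq_inner midpoint_def
    by (simp add: inner_add_left inner_add_right inner_diff_left inner_diff_right inner_commute field_simps)
  with * show ?thesis by simp
qed

lemma weighted_sum_strongly_convex_midpoint:
  assumes p: "\<And>u. u \<in> V \<Longrightarrow> 0 \<le> p u" "(\<Sum>u\<in>V. p u) = 1"
    and g: "\<And>u. u \<in> V \<Longrightarrow> strongly_convex \<mu> (g u)"
  shows "weighted_sum V p g (midpoint x y)
    \<le> (weighted_sum V p g x + weighted_sum V p g y) / 2 - \<mu> / 8 * (norm (x - y))\<^sup>2"
proof -
  have "weighted_sum V p g (midpoint x y)
    \<le> (\<Sum>u\<in>V. p u * ((g u x + g u y) / 2 - \<mu> / 8 * (norm (x - y))\<^sup>2))"
    unfolding weighted_sum_def by (intro sum_mono mult_left_mono strongly_convex_midpoint g p)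
  also have "\<dots> = (\<Sum>u\<in>V. p u * (g u x + g u y)) / 2 - (\<Sum>u\<in>V. p u) * (\<mu> / 8 * (norm (x - y))\<^sup>2)"
    by (simp add: right_diff_distrib sum_subtractf sum_distrib_right sum_divide_distrib)
  finally show ?thesis
    by (simp add: weighted_sum_def p distrib_left sum.distrib)
qed

lemma is_arg_min_le: "is_arg_min F P x \<Longrightarrow> P y \<Longrightarrow> F x \<le> (F y :: 'b::linorder)"
  by (auto simp: is_arg_min_def not_less)

text \<open>The family \<open>S\<close> is left abstract to serve both algorithms. Before the first
  visit the default \<open>last_visit = 1\<close> yields the anchor \<open>\<theta> 0\<close>, which
  is that of the initial surrogate.\<close>

lemma stored_surrogate:
  assumes "\<And>u. u \<in> V \<Longrightarrow> g 0 u \<in> S u (\<theta> 0)"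
    and "\<And>n. 1 \<le> n \<Longrightarrow> g n (v n) \<in> S (v n) (\<theta> (n - 1))"
    and "\<And>n u. 1 \<le> n \<Longrightarrow> u \<in> V - {v n} \<Longrightarrow> g n u = g (n - 1) u"
    and "u \<in> V"
  shows "g n u \<in> S u (\<theta> (last_visit v u n - 1))"
proof (induction n)
  case 0
  then show ?case using assms by simp
next
  case (Suc n)
  then show ?case
    using assms(2)[of "Suc n"] assms(3)[of "Suc n" u] assms(4) by (auto simp: last_visit_Suc)
qed

text \<open>The fresh surrogate agrees with \<open>f w\<close> at its anchor \<open>x\<close>, where
  the old one is at least \<open>f w\<close>. This lets the objective values telescope although the
  surrogates change.\<close>

lemma surrogate_update_decreases:
  assumes p: "\<And>u. u \<in> V \<Longrightarrow> 0 \<le> p u" and x: "x \<in> \<Theta>"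
    and new: "w \<in> V \<Longrightarrow> g' w \<in> surrogates \<Theta> L (f w) x"
    and same: "\<And>u. u \<in> V - {w} \<Longrightarrow> g' u = g u"
    and old: "\<And>u. u \<in> V \<Longrightarrow> g u \<in> surrogates \<Theta> L (f u) (t u)"
  shows "weighted_sum V p g' x \<le> weighted_sum V p g x"
  unfolding weighted_sum_def
proof (intro sum_mono mult_left_mono p)
  fix u assume u: "u \<in> V"
  show "g' u x \<le> g u x"
  proof (cases "u = w")
    case True
    then show ?thesis
      using new old[OF u] u x by (auto simp: surrogates_def)
  next
    case False
    then show ?thesis using same[of u] u by simp
  qed
qed

lemma weighted_sum_surrogates:
  assumes "\<And>u. u \<in> V \<Longrightarrow> g u \<in> surrogates \<Theta> L (f u) (t u)"
  shows "(\<And>u. u \<in> V \<Longrightarrow> 0 \<le> p u) \<Longrightarrow> x \<in> \<Theta> \<Longrightarrow> weighted_sum V p f x \<le> weighted_sum V p g x"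
    and "(\<And>u. u \<in> V \<Longrightarrow> t u = y) \<Longrightarrow> weighted_sum V p g y = weighted_sum V p f y"
  using assms unfolding weighted_sum_def surrogates_def
  by (auto intro!: sum_mono mult_left_mono sum.cong)

subsection \<open>Descent along a sample path\<close>

text \<open>Keeps windows reaching \<open>max_lag\<close> back from \<open>n\<close> within times at
  least 1, where radii are positive.\<close>

lemma max_lag_less:
  assumes "finite V" "V \<noteq> {}" "1 \<le> n"
  shows "max_lag V v n < n"
proof -
  have "n - last_visit v u n < n" for u
    using last_visit_ge_1[of v u n] assms(3) by simp
  then show ?thesis
    using assms by (simp add: max_lag_def)
qed

lemma last_visit_ge_lag:
  assumes "finite V" "u \<in> V" "1 \<le> n"
  shows "n - max_lag V v n \<le> last_visit v u n"
  using lag_le_max_lag[OF assms(1,2), of n v] by simp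

lemma dyn_reg_bounds:
  assumes V: "finite V" "V \<noteq> {}" and n: "1 \<le> n"
  shows "\<rho> \<le> dyn_reg V \<rho> v n" "dyn_reg V \<rho> v n \<le> \<rho> + real (max_lag V v n)"
proof -
  obtain u where u: "u \<in> V" using V by blast
  have "0 \<le> real n - real (last_visit v u n)"
    using last_visit_le[OF n, of v u] by simp
  also have "\<dots> \<le> Max ((\<lambda>u. real n - real (last_visit v u n)) ` V)"
    using V u by simp
  finally show "\<rho> \<le> dyn_reg V \<rho> v n"
    by (simp add: dyn_reg_def)
  have "real n - real (last_visit v u n) \<le> real (max_lag V v n)" if "u \<in> V" for u
    using lag_le_max_lag[OF V(1) that, of n v] by linarith
  then show "dyn_reg V \<rho> v n \<le> \<rho> + real (max_lag V v n)"
    using V by (simp add: dyn_reg_def)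
qed

section \<open>Paths of Algorithm 1\<close>

lemma algorithm1_pathD:
  assumes "algorithm1_path V p \<Theta> f L \<rho> \<mu> v \<theta> g"
  shows "\<theta> 0 \<in> \<Theta>" "u \<in> V \<Longrightarrow> g 0 u \<in> strong_surrogates \<Theta> L \<mu> (f u) (\<theta> 0)"
    and "1 \<le> n \<Longrightarrow> g n (v n) \<in> strong_surrogates \<Theta> L \<mu> (f (v n)) (\<theta> (n - 1))"
    and "1 \<le> n \<Longrightarrow> u \<in> V - {v n} \<Longrightarrow> g n u = g (n - 1) u"
    and "1 \<le> n \<Longrightarrow> is_arg_min (\<lambda>x. weighted_sum V p (g n) x + dyn_reg V \<rho> v n / 2 * (norm (x - \<theta> (n - 1)))\<^sup>2) (\<lambda>x. x \<in> \<Theta>) (\<theta> n)"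
  using assms unfolding algorithm1_path_def by blast+

lemma algorithm1_in_domain:
  assumes "algorithm1_path V p \<Theta> f L \<rho> \<mu> v \<theta> g"
  shows "\<theta> n \<in> \<Theta>"
proof (cases "1 \<le> n")
  case True
  then show ?thesis
    using algorithm1_pathD(5)[OF assms] by (simp add: is_arg_min_def)
next
  case False
  then show ?thesis
    using algorithm1_pathD(1)[OF assms] by (simp add: not_le)
qed

lemma algorithm1_stored:
  assumes alg: "algorithm1_path V p \<Theta> f L \<rho> \<mu> v \<theta> g" and u: "u \<in> V"
  shows "g n u \<in> strong_surrogates \<Theta> L \<mu> (f u) (\<theta> (last_visit v u n - 1))"
  by (rule stored_surrogate[where S = "\<lambda>u. strong_surrogates \<Theta> L \<mu> (f u)" and V = V and g = g])
    (use algorithm1_pathD(2-4)[OF alg] u in blast)+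

lemma algorithm1_surrogates:
  assumes "algorithm1_path V p \<Theta> f L \<rho> \<mu> v \<theta> g" "u \<in> V"
  shows "g n u \<in> surrogates \<Theta> L (f u) (\<theta> (last_visit v u n - 1))"
  using algorithm1_stored[OF assms] by (simp add: strong_surrogates_def)

text \<open>Testing minimality at the midpoint lets the strong convexity of the surrogates contribute, so that
  there is a decrease also if \<open>dyn_reg\<close> vanishes.\<close>

lemma algorithm1_descent:
  assumes alg: "algorithm1_path V p \<Theta> f L \<rho> \<mu> v \<theta> g"
    and V: "finite V" "V \<noteq> {}" and p: "\<And>u. u \<in> V \<Longrightarrow> 0 \<le> p u" "(\<Sum>u\<in>V. p u) = 1"
    and \<Theta>: "convex \<Theta>" and \<rho>: "0 \<le> \<rho>" and n: "1 \<le> n"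
  shows "weighted_sum V p (g n) (\<theta> n) + (\<rho> + \<mu>) / 4 * (norm (\<theta> n - \<theta> (n - 1)))\<^sup>2
    \<le> weighted_sum V p (g (n - 1)) (\<theta> (n - 1))"
proof -
  let ?x = "\<theta> n" and ?y = "\<theta> (n - 1)" and ?G = "weighted_sum V p (g n)"
  let ?R = "dyn_reg V \<rho> v n" and ?m = "midpoint (\<theta> n) (\<theta> (n - 1))"
  let ?\<delta> = "(norm (?x - ?y))\<^sup>2"
  note dom = algorithm1_in_domain[OF alg] and stored = algorithm1_stored[OF alg]
  have "?m \<in> \<Theta>"
    using convexD[OF \<Theta> dom dom, of "1/2" "1/2" n "n - 1"] by (simp add: midpoint_def scaleR_add_right)
  then have "?G ?x + ?R / 2 * ?\<delta> \<le> ?G ?m + ?R / 2 * (norm (?m - ?y))\<^sup>2"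
    by (rule is_arg_min_le[OF algorithm1_pathD(5)[OF alg n]])
  also have "?m - ?y = (1 / 2) *\<^sub>R (?x - ?y)"
    by (simp add: midpoint_def algebra_simps flip: scaleR_add_left)
  also have "(norm ((1 / 2) *\<^sub>R (?x - ?y)))\<^sup>2 = ?\<delta> / 4"
    by (simp add: power_mult_distrib power_divide)
  finally have 1: "?G ?x + ?R / 2 * ?\<delta> \<le> ?G ?m + ?R / 2 * (?\<delta> / 4)" .
  have "?G ?m \<le> (?G ?x + ?G ?y) / 2 - \<mu> / 8 * ?\<delta>"
    using stored by (intro weighted_sum_strongly_convex_midpoint p) (auto simp: strong_surrogates_def)
  \<comment> \<open>The midpoint halves the step, so its proximal term is a quarter of that at
    \<open>?x\<close>; \<open>3/4\<close> of it remains after doubling the inequality.\<close>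
  with 1 have 2: "?G ?x + ?R * (3 / 4 * ?\<delta>) + \<mu> / 4 * ?\<delta> \<le> ?G ?y"
    by (simp add: field_simps)
  \<comment> \<open>Lowering \<open>3/4\<close> to \<open>1/4\<close> gives \<open>\<rho>\<close>
    and \<open>\<mu>\<close> a common coefficient.\<close>
  have 3: "\<rho> * (1 / 4 * ?\<delta>) \<le> ?R * (3 / 4 * ?\<delta>)"
    using dyn_reg_bounds(1)[OF V n, of \<rho> v] \<rho> by (intro mult_mono) auto
  have 4: "?G ?y \<le> weighted_sum V p (g (n - 1)) ?y"
  proof (rule surrogate_update_decreases[OF p(1) dom, where w = "v n"])
    show "g (n - 1) u \<in> surrogates \<Theta> L (f u) (\<theta> (last_visit v u (n - 1) - 1))" if "u \<in> V" for u
      by (rule algorithm1_surrogates[OF alg that])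
  qed (use algorithm1_pathD(3,4)[OF alg n] in \<open>simp_all add: strong_surrogates_def\<close>)
  from 2 3 4 show ?thesis
    by (simp add: field_simps)
qed

text \<open>Telescopes \<open>algorithm1_descent\<close>. The averaged surrogate majorizes the
  objective at \<open>\<theta> n\<close> and equals it at \<open>\<theta> 0\<close>, the common
  anchor of the initial surrogates.\<close>

lemma algorithm1_sum_steps:
  assumes alg: "algorithm1_path V p \<Theta> f L \<rho> \<mu> v \<theta> g"
    and V: "finite V" "V \<noteq> {}" and p: "\<And>u. u \<in> V \<Longrightarrow> 0 \<le> p u" "(\<Sum>u\<in>V. p u) = 1"
    and \<Theta>: "convex \<Theta>" and \<rho>: "0 \<le> \<rho>"
  shows "(\<rho> + \<mu>) / 4 * (\<Sum>i\<in>{1..n}. (norm (\<theta> i - \<theta> (i - 1)))\<^sup>2)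
    \<le> weighted_sum V p f (\<theta> 0) - weighted_sum V p f (\<theta> n)"
proof -
  note stored = algorithm1_surrogates[OF alg]
  have "weighted_sum V p (g n) (\<theta> n) + (\<rho> + \<mu>) / 4 * (\<Sum>i\<in>{1..n}. (norm (\<theta> i - \<theta> (i - 1)))\<^sup>2)
    \<le> weighted_sum V p (g 0) (\<theta> 0)"
  proof (induction n)
    case (Suc n)
    then show ?case
      using algorithm1_descent[OF alg V p \<Theta> \<rho>, of "Suc n"] by (simp add: distrib_left)
  qed simp
  moreover have "weighted_sum V p f (\<theta> n) \<le> weighted_sum V p (g n) (\<theta> n)"
    by (rule weighted_sum_surrogates(1)[OF stored p(1) algorithm1_in_domain[OF alg]])
  moreover have "weighted_sum V p (g 0) (\<theta> 0) = weighted_sum V p f (\<theta> 0)"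
    by (rule weighted_sum_surrogates(2)[OF stored]) simp_all
  ultimately show ?thesis by linarith
qed

text \<open>The iterate minimizes the objective plus a smooth remainder, namely the surrogate gap
  and the proximal term. Its gradient is controlled by the distances to the anchors and by the last
  step, all covered by the last \<open>max_lag + 1\<close> steps.\<close>

lemma algorithm1_opt_gap:
  assumes alg: "algorithm1_path V p \<Theta> f L \<rho> \<mu> v \<theta> g"
    and V: "finite V" "V \<noteq> {}" and p: "\<And>u. u \<in> V \<Longrightarrow> 0 \<le> p u" "(\<Sum>u\<in>V. p u) = 1"
    and \<Theta>: "convex \<Theta>" and \<rho>: "0 \<le> \<rho>" and L: "0 \<le> L" and n: "1 \<le> n"
    and dir: "\<And>u x y. u \<in> V \<Longrightarrow> x \<in> \<Theta> \<Longrightarrow> y \<in> \<Theta> \<Longrightarrow> has_dir_deriv (f u) x (y - x)"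
  shows "opt_gap \<Theta> (weighted_sum V p f) (\<theta> n) \<le>
    ereal ((\<rho> + L + max_lag V v n) * (\<Sum>i\<in>{n - max_lag V v n..n}. norm (\<theta> i - \<theta> (i - 1))))"
proof -
  let ?D = "max_lag V v n" and ?R = "dyn_reg V \<rho> v n"
  let ?\<delta> = "\<lambda>i. norm (\<theta> i - \<theta> (i - 1))"
  let ?S = "\<Sum>i\<in>{n - ?D..n}. ?\<delta> i"
  let ?t = "\<lambda>u. \<theta> (last_visit v u n - 1)"
  let ?f = "weighted_sum V p f" and ?g = "weighted_sum V p (g n)"
  note dom = algorithm1_in_domain[OF alg]
  note stored = algorithm1_surrogates[OF alg]
  obtain G where G: "\<And>x. GDERIV (\<lambda>x. ?g x - ?f x) x :> G x" "L-lipschitz_on UNIV G"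
    "\<And>x. norm (G x) \<le> L * (\<Sum>u\<in>V. p u * norm (x - ?t u))"
    by (rule surrogate_gap_gradient[of L V p "g n" \<Theta> f ?t, OF L p stored]) (assumption | rule that)+
  have "opt_gap \<Theta> ?f (\<theta> n) \<le> ereal (norm (G (\<theta> n) + ?R *\<^sub>R (\<theta> n - \<theta> (n - 1))))"
  proof (rule opt_gap_minimizer_le[OF \<Theta> dom _ GDERIV_add[OF G(1) GDERIV_half_norm_square]])
    show "has_dir_deriv ?f (\<theta> n) (y - \<theta> n)" if "y \<in> \<Theta>" for y
      by (intro has_dir_deriv_weighted_sum dir dom that)
    show "?f (\<theta> n) + (?g (\<theta> n) - ?f (\<theta> n) + ?R / 2 * (norm (\<theta> n - \<theta> (n - 1)))\<^sup>2)
      \<le> ?f y + (?g y - ?f y + ?R / 2 * (norm (y - \<theta> (n - 1)))\<^sup>2)" if "y \<in> \<Theta>" for y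
      using is_arg_min_le[OF algorithm1_pathD(5)[OF alg n] that] by simp
  qed
  also have "norm (G (\<theta> n) + ?R *\<^sub>R (\<theta> n - \<theta> (n - 1))) \<le> norm (G (\<theta> n)) + \<bar>?R\<bar> * ?\<delta> n"
    using norm_triangle_ineq[of "G (\<theta> n)" "?R *\<^sub>R (\<theta> n - \<theta> (n - 1))"] by simp
  also have "norm (G (\<theta> n)) \<le> L * ?S"
  proof -
    have "norm (\<theta> n - ?t u) \<le> ?S" if u: "u \<in> V" for u
    proof -
      \<comment> \<open>Applied at \<open>n + 1\<close> so that the sum includes the step arriving
        at \<open>\<theta> n\<close>.\<close>
      have "norm (\<theta> (n + 1 - 1) - ?t u) \<le> (\<Sum>i\<in>{last_visit v u n..<n + 1}. ?\<delta> i)"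
        using last_visit_ge_1[of v u n] last_visit_le[OF n, of v u] by (intro norm_diff_le_sum_steps) auto
      also have "\<dots> \<le> ?S"
        using last_visit_ge_lag[OF V(1) u n, of v] by (intro sum_mono2) auto
      finally show ?thesis by simp
    qed
    then have "(\<Sum>u\<in>V. p u * norm (\<theta> n - ?t u)) \<le> (\<Sum>u\<in>V. p u * ?S)"
      using p by (intro sum_mono mult_left_mono) auto
    also have "\<dots> = ?S"
      by (simp add: p flip: sum_distrib_right)
    finally show ?thesis
      by (intro order_trans[OF G(3)] mult_left_mono L)
  qed
  also have "\<bar>?R\<bar> * ?\<delta> n \<le> (\<rho> + ?D) * ?S"
    using dyn_reg_bounds[OF V n, of \<rho> v] \<rho>
    by (intro mult_mono member_le_sum[of n "{n - ?D..n}" ?\<delta>]) auto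
  finally show ?thesis
    by (simp add: algebra_simps)
qed

section \<open>Paths of Algorithm 2\<close>

lemma algorithm2_pathD:
  assumes "algorithm2_path V p \<Theta> f L r v \<theta> g"
  shows "\<theta> 0 \<in> \<Theta>" "u \<in> V \<Longrightarrow> g 0 u \<in> surrogates \<Theta> L (f u) (\<theta> 0)"
    and "1 \<le> n \<Longrightarrow> g n (v n) \<in> surrogates \<Theta> L (f (v n)) (\<theta> (n - 1))"
    and "1 \<le> n \<Longrightarrow> u \<in> V - {v n} \<Longrightarrow> g n u = g (n - 1) u"
    and "1 \<le> n \<Longrightarrow> is_arg_min (weighted_sum V p (g n)) (\<lambda>x. x \<in> \<Theta> \<inter> cball (\<theta> (n - 1)) (r n)) (\<theta> n)"
  using assms unfolding algorithm2_path_def by blast+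

lemma algorithm2_in_domain:
  assumes "algorithm2_path V p \<Theta> f L r v \<theta> g"
  shows "\<theta> n \<in> \<Theta>"
proof (cases "1 \<le> n")
  case True
  then show ?thesis
    using algorithm2_pathD(5)[OF assms] by (simp add: is_arg_min_def)
next
  case False
  then show ?thesis
    using algorithm2_pathD(1)[OF assms] by (simp add: not_le)
qed

lemma algorithm2_stored:
  assumes alg: "algorithm2_path V p \<Theta> f L r v \<theta> g" and u: "u \<in> V"
  shows "g n u \<in> surrogates \<Theta> L (f u) (\<theta> (last_visit v u n - 1))"
  by (rule stored_surrogate[where S = "\<lambda>u. surrogates \<Theta> L (f u)" and V = V and g = g])
    (use algorithm2_pathD(2-4)[OF alg] u in blast)+

lemma algorithm2_step_le:
  assumes "algorithm2_path V p \<Theta> f L r v \<theta> g" "1 \<le> n"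
  shows "norm (\<theta> n - \<theta> (n - 1)) \<le> r n"
  using algorithm2_pathD(5)[OF assms] by (simp add: is_arg_min_def dist_norm norm_minus_commute)

lemma algorithm2_surrogate_decreases:
  assumes alg: "algorithm2_path V p \<Theta> f L r v \<theta> g" and p: "\<And>u. u \<in> V \<Longrightarrow> 0 \<le> p u" and n: "1 \<le> n"
  shows "weighted_sum V p (g n) (\<theta> (n - 1)) \<le> weighted_sum V p (g (n - 1)) (\<theta> (n - 1))"
proof (rule surrogate_update_decreases[OF p algorithm2_in_domain[OF alg], where w = "v n"])
  show "g (n - 1) u \<in> surrogates \<Theta> L (f u) (\<theta> (last_visit v u (n - 1) - 1))" if "u \<in> V" for u
    by (rule algorithm2_stored[OF alg that])
qed (use algorithm2_pathD(3,4)[OF alg n] in simp_all)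

text \<open>The competitor moves from the previous iterate by the fraction \<open>r n\<close> of
  \<open>y - \<theta> (n - 1)\<close>. The descent lemma for the objective and for the gap costs
  \<open>2 * L * (r n)\<^sup>2\<close>; the gradient of the gap, bounded by the drift from the
  anchors, costs the window sum.\<close>

lemma algorithm2_descent:
  assumes alg: "algorithm2_path V p \<Theta> f L r v \<theta> g"
    and V: "finite V" "V \<noteq> {}" and p: "\<And>u. u \<in> V \<Longrightarrow> 0 \<le> p u" "(\<Sum>u\<in>V. p u) = 1"
    and \<Theta>: "convex \<Theta>" and L: "0 \<le> L" and n: "1 \<le> n"
    and r: "\<And>n. 1 \<le> n \<Longrightarrow> 0 < r n" "antimono_on {1..} r" "r n \<le> 1"
    and F: "\<And>x. GDERIV (weighted_sum V p f) x :> F x" "L-lipschitz_on UNIV F"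
    and y: "y \<in> \<Theta>" "norm (y - \<theta> (n - 1)) \<le> 1"
  shows "r n * (- inner (F (\<theta> (n - 1))) (y - \<theta> (n - 1))) \<le>
    weighted_sum V p (g (n - 1)) (\<theta> (n - 1)) - weighted_sum V p (g n) (\<theta> n)
    + 2 * L * (r n)\<^sup>2 + L * (\<Sum>i\<in>{n - max_lag V v n..<n}. (r i)\<^sup>2)"
proof -
  let ?D = "max_lag V v n" and ?x = "\<theta> (n - 1)"
  let ?t = "\<lambda>u. \<theta> (last_visit v u n - 1)" and ?d = "r n *\<^sub>R (y - \<theta> (n - 1))"
  let ?f = "weighted_sum V p f" and ?g = "weighted_sum V p (g n)"
  note dom = algorithm2_in_domain[OF alg] and stored = algorithm2_stored[OF alg]
  have rn: "0 < r n" using r n by simp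
  obtain G where G: "\<And>x. GDERIV (\<lambda>x. ?g x - ?f x) x :> G x" "L-lipschitz_on UNIV G"
    "\<And>x. norm (G x) \<le> L * (\<Sum>u\<in>V. p u * norm (x - ?t u))"
    by (rule surrogate_gap_gradient[of L V p "g n" \<Theta> f ?t, OF L p stored]) (assumption | rule that)+
  have d: "norm ?d \<le> r n"
    using y rn by (simp add: mult_left_le)
  have "?x + ?d = (1 - r n) *\<^sub>R ?x + r n *\<^sub>R y"
    by (simp add: algebra_simps)
  also have "\<dots> \<in> \<Theta>"
    using rn r(3) by (intro convexD[OF \<Theta>] dom y) auto
  finally have "?x + ?d \<in> \<Theta> \<inter> cball ?x (r n)"
    using d by (simp add: dist_norm)
  then have 1: "?g (\<theta> n) \<le> ?g (?x + ?d)"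
    by (rule is_arg_min_le[OF algorithm2_pathD(5)[OF alg n]])
  have 2: "?f (?x + ?d) \<le> ?f ?x + inner (F ?x) ?d + L * (norm ?d)\<^sup>2"
    by (rule lipschitz_gradient_upper_bound[OF F])
  have 3: "?g (?x + ?d) - ?f (?x + ?d) \<le> ?g ?x - ?f ?x + inner (G ?x) ?d + L * (norm ?d)\<^sup>2"
    by (rule lipschitz_gradient_upper_bound[OF G(1,2)])
  have 4: "L * (norm ?d)\<^sup>2 \<le> L * (r n)\<^sup>2"
    using d L by (intro mult_left_mono power_mono) auto
  have 5: "?g ?x \<le> weighted_sum V p (g (n - 1)) ?x"
    by (rule algorithm2_surrogate_decreases[OF alg p(1) n])
  have D: "?D < n" by (rule max_lag_less[OF V n])
  have "norm (?x - ?t u) * r n \<le> (\<Sum>i\<in>{n - ?D..<n}. (r i)\<^sup>2)" if u: "u \<in> V" for u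
  proof -
    have "norm (?x - ?t u) \<le> (\<Sum>i\<in>{last_visit v u n..<n}. norm (\<theta> i - \<theta> (i - 1)))"
      using last_visit_ge_1[of v u n] last_visit_le[OF n, of v u] by (intro norm_diff_le_sum_steps) auto
    also have "\<dots> \<le> (\<Sum>i\<in>{last_visit v u n..<n}. r i)"
      using last_visit_ge_1[of v u n] by (intro sum_mono algorithm2_step_le[OF alg]) auto
    also have "\<dots> \<le> (\<Sum>i\<in>{n - ?D..<n}. r i)"
      using last_visit_ge_lag[OF V(1) u n, of v] D by (intro sum_mono2) (auto intro!: less_imp_le[OF r(1)])
    finally have "norm (?x - ?t u) * r n \<le> (\<Sum>i\<in>{n - ?D..<n}. r i * r n)"
      using rn by (simp add: mult_right_mono flip: sum_distrib_right)
    \<comment> \<open>Monotonicity of the radii replaces the product of radii by a square, so that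
      \<open>\<Sum> (r i)\<^sup>2\<close> controls the drift.\<close>
    also have "\<dots> \<le> (\<Sum>i\<in>{n - ?D..<n}. (r i)\<^sup>2)"
    proof (intro sum_mono)
      fix i assume i: "i \<in> {n - ?D..<n}"
      with D have "1 \<le> i" "i \<le> n" by auto
      then have "r n \<le> r i" "0 < r i"
        using r(1,2) n by (auto simp: monotone_on_def)
      then show "r i * r n \<le> (r i)\<^sup>2"
        by (simp add: power2_eq_square mult_left_mono)
    qed
    finally show ?thesis .
  qed
  then have "(\<Sum>u\<in>V. p u * (norm (?x - ?t u) * r n)) \<le> (\<Sum>u\<in>V. p u * (\<Sum>i\<in>{n - ?D..<n}. (r i)\<^sup>2))"
    using p by (intro sum_mono mult_left_mono) auto
  also have "\<dots> = (\<Sum>i\<in>{n - ?D..<n}. (r i)\<^sup>2)"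
    by (simp add: p flip: sum_distrib_right)
  finally have 6: "(\<Sum>u\<in>V. p u * norm (?x - ?t u)) * r n \<le> (\<Sum>i\<in>{n - ?D..<n}. (r i)\<^sup>2)"
    by (simp add: sum_distrib_right mult.assoc)
  have "inner (G ?x) ?d \<le> norm (G ?x) * norm ?d"
    by (rule norm_cauchy_schwarz)
  also have "\<dots> \<le> L * (\<Sum>u\<in>V. p u * norm (?x - ?t u)) * r n"
    using G(3)[of ?x] d L p by (intro mult_mono) (auto intro!: mult_nonneg_nonneg sum_nonneg)
  also have "\<dots> \<le> L * (\<Sum>i\<in>{n - ?D..<n}. (r i)\<^sup>2)"
    using 6 L by (simp add: mult.assoc mult_left_mono)
  finally show ?thesis
    using 1 2 3 4 5 by simp
qed

text \<open>Once an iterate is close to a non-stationary limit point, the summable bound \<open>b\<close> on the progress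
  forbids the iterates to leave a neighbourhood of it; staying there contradicts \<open>\<Sum>r = \<infinity>\<close>.\<close>

lemma limit_point_stationary:
  fixes x :: "nat \<Rightarrow> 'a::real_inner"
  assumes \<Theta>: "convex \<Theta>" "z \<in> \<Theta>"
    and F: "\<And>x. GDERIV f x :> F x" "continuous_on UNIV F"
    and r: "\<And>n. 0 < r n" "\<not> summable r"
    and b: "\<And>n. 0 \<le> b n" "summable b"
    and step: "\<And>n. norm (x (Suc n) - x n) \<le> r n"
    and progress: "\<And>n y. N \<le> n \<Longrightarrow> y \<in> \<Theta> \<Longrightarrow> norm (y - x n) \<le> 1 \<Longrightarrow>
      r n * (- inner (F (x n)) (y - x n)) \<le> b n"
    and lim: "seq_limit_point x z"
  shows "stationary_point \<Theta> f z"
proof (rule ccontr)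
  assume "\<not> stationary_point \<Theta> f z"
  then have "\<not> opt_gap \<Theta> f z \<le> 0"
    using opt_gap_nonneg[OF \<Theta>(2), of f] \<Theta>(2) by (auto simp: stationary_point_def)
  then obtain y where y: "y \<in> \<Theta>" "norm (y - z) \<le> 1" "\<not> ereal (- dir_deriv f z (y - z)) \<le> 0"
    unfolding opt_gap_def SUP_le_iff by blast
  \<comment> \<open>Halving the direction keeps the derivative negative and leaves a margin: with
    \<open>\<delta> \<le> 1 / 2\<close>, \<open>y'\<close> is within distance 1 of every iterate
    closer than \<open>\<delta>\<close> to \<open>z\<close>.\<close>
  define y' where "y' = midpoint z y"
  have y'z: "y' - z = (1 / 2) *\<^sub>R (y - z)"
    by (simp add: y'_def midpoint_def algebra_simps flip: scaleR_add_left)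
  have y': "y' \<in> \<Theta>"
    using convexD[OF \<Theta>(1) \<Theta>(2) y(1), of "1/2" "1/2"] by (simp add: y'_def midpoint_def scaleR_add_right)
  define \<psi> where "\<psi> = (\<lambda>w. - inner (F w) (y' - w))"
  define \<epsilon> where "\<epsilon> = \<psi> z / 2"
  have \<epsilon>: "0 < \<epsilon>"
    using y(3) by (simp add: \<epsilon>_def \<psi>_def y'z dir_deriv_GDERIV[OF F(1)])
  have "isCont \<psi> z"
    using F(2) unfolding \<psi>_def by (intro continuous_intros) (simp add: continuous_on_eq_continuous_at)
  then have "\<forall>\<^sub>F w in nhds z. \<epsilon> < \<psi> w"
    using \<epsilon> by (intro order_tendstoD(1)[of \<psi> "\<psi> z"]) (auto simp: isCont_def \<epsilon>_def tendsto_at_iff_tendsto_nhds)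
  then obtain \<delta>0 where \<delta>0: "0 < \<delta>0" "\<And>w. dist w z < \<delta>0 \<Longrightarrow> \<epsilon> < \<psi> w"
    unfolding eventually_nhds_metric by blast
  define \<delta> where "\<delta> = min \<delta>0 (1 / 2)"
  have \<delta>: "0 < \<delta>" "\<delta> \<le> 1 / 2" "\<delta> \<le> \<delta>0"
    using \<delta>0 by (auto simp: \<delta>_def)
  have near: "\<epsilon> * r n \<le> b n" if "N \<le> n" "dist (x n) z < \<delta>" for n
  proof -
    have "norm (y' - x n) \<le> norm (y' - z) + norm (z - x n)"
      using norm_triangle_ineq[of "y' - z" "z - x n"] by simp
    also have "\<dots> \<le> 1"
      using that(2) \<delta> y(2) by (simp add: y'z dist_norm norm_minus_commute)
    finally have "r n * \<psi> (x n) \<le> b n"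
      using progress[OF that(1) y'] by (simp add: \<psi>_def)
    moreover have "r n * \<epsilon> \<le> r n * \<psi> (x n)"
      using \<delta>0(2)[of "x n"] that(2) \<delta> r(1)[of n] by (intro mult_left_mono) auto
    ultimately show ?thesis by (simp add: mult.commute)
  qed
  have "0 < \<epsilon> * (\<delta> / 2)" using \<epsilon> \<delta> by simp
  with b(2) obtain N' where N': "\<And>m n. N' \<le> m \<Longrightarrow> norm (sum b {m..<n}) < \<epsilon> * (\<delta> / 2)"
    unfolding summable_Cauchy by blast
  obtain s where s: "strict_mono s" "(x \<circ> s) \<longlonglongrightarrow> z"
    using lim unfolding seq_limit_point_def by blast
  have s1: "\<forall>\<^sub>F k in sequentially. dist (x (s k)) z < \<delta> / 2"
    using tendstoD[OF s(2), of "\<delta> / 2"] \<delta> by simp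
  have s2: "\<forall>\<^sub>F k in sequentially. max N N' \<le> s k"
    using filterlim_subseq[OF s(1)] unfolding filterlim_at_top by blast
  obtain k where "dist (x (s k)) z < \<delta> / 2 \<and> max N N' \<le> s k"
    using eventually_happens[OF eventually_conj[OF s1 s2]] by auto
  then obtain m where m: "dist (x m) z < \<delta> / 2" "N \<le> m" "N' \<le> m"
    by auto
  \<comment> \<open>While the iterates stay within \<open>\<delta>\<close> of \<open>z\<close>,
    \<open>near\<close> bounds \<open>\<epsilon>\<close> times the radii by a tail of
    \<open>b\<close>, which is below \<open>\<epsilon> * (\<delta> / 2)\<close>.\<close>
  have sum_r: "sum r {m..<n} < \<delta> / 2" if "\<And>i. i \<in> {m..<n} \<Longrightarrow> dist (x i) z < \<delta>" for n
  proof -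
    have "\<epsilon> * sum r {m..<n} \<le> sum b {m..<n}"
      unfolding sum_distrib_left using that m by (intro sum_mono near) auto
    also have "\<dots> < \<epsilon> * (\<delta> / 2)"
      using N'[OF m(3), of n] by simp
    finally show ?thesis using \<epsilon> by simp
  qed
  \<comment> \<open>By strong induction all iterates from \<open>m\<close> up to \<open>n\<close>
    are within \<open>\<delta>\<close>, so the path travelled is shorter than
    \<open>\<delta> / 2\<close>; it started within \<open>\<delta> / 2\<close> of
    \<open>z\<close>.\<close>
  have stay: "dist (x n) z < \<delta>" if "m \<le> n" for n
    using that
  proof (induction n rule: less_induct)
    case (less n)
    have "norm (x n - x m) \<le> (\<Sum>i\<in>{m..<n}. norm (x (Suc i) - x i))"
      using less.prems by (subst sum_Suc_diff'[symmetric]) (auto intro: norm_sum)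
    also have "\<dots> \<le> sum r {m..<n}"
      by (intro sum_mono step)
    also have "\<dots> < \<delta> / 2"
      using less.IH by (intro sum_r) auto
    finally show ?case
      using m(1) dist_triangle[of "x n" z "x m"] by (simp add: dist_norm)
  qed
  have "summable (\<lambda>n. r (n + m))"
  proof (rule summableI_nonneg_bounded)
    show "0 \<le> r (n + m)" for n
      using r(1) by (simp add: less_imp_le)
    show "(\<Sum>i<n. r (i + m)) \<le> \<delta> / 2" for n
    proof -
      have "(\<Sum>i<n. r (i + m)) = sum r {m..<m + n}"
        using sum.shift_bounds_nat_ivl[of r 0 m n] by (simp add: add.commute lessThan_atLeast0)
      then show ?thesis
        using sum_r[of "m + n"] stay by (simp add: less_imp_le)
    qed
  qed
  then show False
    using r(2) by (simp add: summable_iff_shift)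
qed

subsection \<open>Expectations\<close>

text \<open>With \<open>s\<close> the root of order \<open>k + 1\<close> of \<open>q\<close>,
  \<open>k\<close> of the factors \<open>s ^ j\<close> absorb the powers of \<open>a + j\<close>,
  since \<open>(a + j) * s ^ j\<close> is bounded; the remaining factor is a geometric
  series.\<close>

lemma summable_power_times_geometric:
  fixes q a :: real
  assumes q: "0 < q" "q < 1"
  shows "summable (\<lambda>j. (a + real j) ^ k * q ^ j)"
proof -
  define s where "s = root (Suc k) q"
  have s: "0 < s" "s < 1" "s ^ Suc k = q"
    using q unfolding s_def by (auto simp del: power_Suc)
  have "(\<lambda>j. a * s ^ j + real j * s ^ j) \<longlonglongrightarrow> a * 0 + 0"
    using s powser_times_n_limit_0[of s]
    by (intro tendsto_add tendsto_mult tendsto_const LIMSEQ_realpow_zero) auto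
  then have "Bseq (\<lambda>j. a * s ^ j + real j * s ^ j)"
    by (rule convergent_imp_Bseq[OF convergentI])
  then obtain B where B: "\<And>j. \<bar>(a + real j) * s ^ j\<bar> \<le> B"
    unfolding Bseq_def by (auto simp: distrib_right)
  show ?thesis
  proof (rule summable_comparison_test')
    show "summable (\<lambda>j. B ^ k * s ^ j)"
      using s by (intro summable_mult summable_geometric) auto
    fix j
    have "q ^ j = (s ^ j) ^ k * s ^ j"
      unfolding s(3)[symmetric] by (simp add: power_mult_distrib mult.commute flip: power_mult)
    then have "norm ((a + real j) ^ k * q ^ j) = \<bar>(a + real j) * s ^ j\<bar> ^ k * s ^ j"
      using s by (simp add: abs_mult power_mult_distrib power_abs)
    also have "\<dots> \<le> B ^ k * s ^ j"
      using s B by (intro mult_right_mono power_mono) auto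
    finally show "norm ((a + real j) ^ k * q ^ j) \<le> B ^ k * s ^ j" .
  qed
qed

text \<open>The integrand is the term \<open>j = D n \<omega>\<close> of the sum of
  \<open>(a + j) ^ k\<close> over all \<open>j \<le> D n \<omega>\<close>. Integrating the whole sum
  leaves tail probabilities only and a bound uniform in \<open>n\<close>.\<close>

lemma geometric_tail_moment:
  fixes D :: "nat \<Rightarrow> 'w \<Rightarrow> nat"
  assumes D: "\<And>n. D n \<in> M \<rightarrow>\<^sub>M count_space UNIV"
    and tail: "\<And>n j. emeasure M {\<omega> \<in> space M. j \<le> D n \<omega>} \<le> ennreal (c * q ^ j)"
    and q: "0 < c" "0 < q" "q < 1" and a: "0 \<le> a"
  obtains B where "0 \<le> B" "\<And>n. (\<integral>\<^sup>+\<omega>. ennreal ((a + real (D n \<omega>)) ^ k) \<partial>M) \<le> ennreal B"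
proof
  let ?t = "\<lambda>j. (a + real j) ^ k * (c * q ^ j)"
  have t: "summable ?t"
    using summable_mult[OF summable_power_times_geometric[OF q(2,3), of a k], of c] by (simp add: mult_ac)
  have t0: "0 \<le> ?t j" for j using a q by simp
  show "0 \<le> suminf ?t" by (intro suminf_nonneg t t0)
  fix n
  note D[measurable]
  have [measurable]: "{\<omega> \<in> space M. j \<le> D n \<omega>} \<in> sets M" for j by measurable
  have "(\<integral>\<^sup>+\<omega>. ennreal ((a + real (D n \<omega>)) ^ k) \<partial>M)
    \<le> (\<integral>\<^sup>+\<omega>. (\<Sum>j. ennreal ((a + real j) ^ k) * indicator {\<omega> \<in> space M. j \<le> D n \<omega>} \<omega>) \<partial>M)"
  proof (intro nn_integral_mono)
    fix \<omega> assume \<omega>: "\<omega> \<in> space M"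
    let ?f = "\<lambda>j. ennreal ((a + real j) ^ k) * indicator {\<omega> \<in> space M. j \<le> D n \<omega>} \<omega>"
    have "ennreal ((a + real (D n \<omega>)) ^ k) = sum ?f {D n \<omega>}"
      using \<omega> by simp
    also have "\<dots> \<le> (\<Sum>j. ?f j)"
      by (rule sum_le_suminf) auto
    finally show "ennreal ((a + real (D n \<omega>)) ^ k) \<le> (\<Sum>j. ?f j)" .
  qed
  also have "\<dots> = (\<Sum>j. ennreal ((a + real j) ^ k) * emeasure M {\<omega> \<in> space M. j \<le> D n \<omega>})"
    by (simp add: nn_integral_suminf nn_integral_cmult)
  also have "\<dots> \<le> (\<Sum>j. ennreal (?t j))"
  proof (intro suminf_le)
    fix j
    have "ennreal ((a + real j) ^ k) * emeasure M {\<omega> \<in> space M. j \<le> D n \<omega>}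
      \<le> ennreal ((a + real j) ^ k) * ennreal (c * q ^ j)"
      by (intro mult_left_mono tail) simp
    also have "\<dots> = ennreal (?t j)"
      using a q by (intro ennreal_mult[symmetric]) auto
    finally show "ennreal ((a + real j) ^ k) * emeasure M {\<omega> \<in> space M. j \<le> D n \<omega>} \<le> ennreal (?t j)" .
  qed simp_all
  also have "\<dots> = ennreal (suminf ?t)"
    by (rule suminf_ennreal2[OF t0 t])
  finally show "(\<integral>\<^sup>+\<omega>. ennreal ((a + real (D n \<omega>)) ^ k) \<partial>M) \<le> ennreal (suminf ?t)" .
qed

text \<open>\<open>K\<close> is fixed first, making \<open>B / K\<close> small, and only then
  \<open>n\<close> grows; hence \<open>A K\<close> may depend on \<open>K\<close> in any
  way.\<close>

lemma ennreal_tendsto_zeroI: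
  fixes X :: "nat \<Rightarrow> ennreal"
  assumes s: "\<And>K. s K \<longlonglongrightarrow> (0::real)"
    and X: "\<And>K n. 1 \<le> K \<Longrightarrow> 1 \<le> n \<Longrightarrow> X n \<le> ennreal (A K * s K n + B / real K)"
  shows "X \<longlonglongrightarrow> 0"
proof (rule order_tendstoI)
  fix x :: ennreal assume "0 < x"
  then obtain \<epsilon> :: real where \<epsilon>: "0 < \<epsilon>" "ennreal \<epsilon> \<le> x"
    by (cases x) (auto intro: that[of 1])
  obtain K :: nat where "max 1 (2 * B / \<epsilon>) < real K"
    using reals_Archimedean2 by blast
  then have K: "1 \<le> K" "2 * B / \<epsilon> < real K"
    by simp_all
  then have B: "B / real K < \<epsilon> / 2"
    using \<epsilon> by (simp add: field_simps)
  have "(\<lambda>n. A K * s K n) \<longlonglongrightarrow> A K * 0"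
    by (intro tendsto_mult s tendsto_const)
  then have "\<forall>\<^sub>F n in sequentially. A K * s K n < \<epsilon> / 2"
    using \<epsilon> by (intro order_tendstoD(2)[of _ "A K * 0"]) auto
  moreover have "\<forall>\<^sub>F n in sequentially. 1 \<le> n"
    by (rule eventually_ge_at_top)
  ultimately show "\<forall>\<^sub>F n in sequentially. X n < x"
  proof eventually_elim
    case (elim n)
    have "X n \<le> ennreal (A K * s K n + B / real K)"
      by (rule X[OF K(1) elim(2)])
    also have "\<dots> < ennreal \<epsilon>"
      using elim B \<epsilon> by (intro ennreal_lessI) linarith+
    finally show ?case using \<epsilon>(2) by simp
  qed
qed simp

text \<open>On \<open>{D \<le> K}\<close> only the last \<open>K\<close> steps enter, and these vanish in expectation; on \<open>{D > K}\<close> the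
  total squared length is bounded and one more moment of \<open>D\<close> gains a factor \<open>1 / K\<close>.\<close>

lemma expected_window_tendsto_zero:
  fixes D :: "nat \<Rightarrow> 'w \<Rightarrow> nat" and \<delta> :: "nat \<Rightarrow> 'w \<Rightarrow> real"
  assumes M: "prob_space M"
    and D: "\<And>n. D n \<in> M \<rightarrow>\<^sub>M count_space UNIV"
    and \<delta>: "\<And>i. \<delta> i \<in> borel_measurable M" "\<And>i \<omega>. 0 \<le> \<delta> i \<omega>"
    and C: "\<And>n \<omega>. \<omega> \<in> space M \<Longrightarrow> (\<Sum>i\<le>n. \<delta> i \<omega>) \<le> C"
    and B: "\<And>n. (\<integral>\<^sup>+\<omega>. ennreal ((a + real (D n \<omega>)) ^ Suc k) \<partial>M) \<le> ennreal B"
    and nonneg: "0 \<le> a" "0 \<le> B" "0 \<le> C"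
  shows "(\<lambda>n. \<integral>\<^sup>+\<omega>. ennreal ((a + real (D n \<omega>)) ^ k * (\<Sum>i\<in>{n - D n \<omega>..n}. \<delta> i \<omega>)) \<partial>M) \<longlonglongrightarrow> 0"
proof -
  interpret prob_space M by (rule M)
  note [measurable] = D \<delta>(1)
  have window: "(\<Sum>i\<in>{m..n}. \<delta> i \<omega>) \<le> C" if "\<omega> \<in> space M" for m n \<omega>
    using sum_mono2[of "{..n}" "{m..n}" "\<lambda>i. \<delta> i \<omega>"] \<delta>(2) C[OF that, of n] by fastforce
  have bound: "\<delta> i \<omega> \<le> C" if "\<omega> \<in> space M" for i \<omega>
    using window[OF that, of i i] by simp
  have int: "integrable M (\<delta> i)" for i
    using bound \<delta>(2) by (intro integrable_const_bound[of _ C]) (auto intro!: AE_I2)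
  define e where "e = (\<lambda>i. expectation (\<delta> i))"
  have e0: "0 \<le> e i" for i
    using \<delta>(2) by (simp add: e_def)
  \<comment> \<open>The pathwise bound \<open>C\<close> passes to expectations, so that windows of
    fixed length have vanishing expected sum.\<close>
  have "summable e"
  proof (rule summableI_nonneg_bounded[OF e0])
    fix n
    have "(\<Sum>i<n. e i) = expectation (\<lambda>\<omega>. \<Sum>i<n. \<delta> i \<omega>)"
      unfolding e_def by (simp add: int)
    also have "\<dots> \<le> C"
    proof (rule integral_le_const)
      have "(\<Sum>i<n. \<delta> i \<omega>) \<le> C" if "\<omega> \<in> space M" for \<omega>
        using sum_mono2[of "{..n}" "{..<n}" "\<lambda>i. \<delta> i \<omega>"] \<delta>(2) C[OF that, of n] by fastforce
      then show "AE \<omega> in M. (\<Sum>i<n. \<delta> i \<omega>) \<le> C" by (intro AE_I2)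
    qed (auto intro: int)
    finally show "(\<Sum>i<n. e i) \<le> C" .
  qed
  then have lim: "(\<lambda>n. sum e {..<n}) \<longlonglongrightarrow> suminf e"
    by (rule summable_LIMSEQ)
  have tail: "(\<lambda>n. sum e {n - K..n}) \<longlonglongrightarrow> 0" for K
  proof -
    have "sum e {n - K..n} = sum e {..<Suc n} - sum e {..<n - K}" for n
      using sum_diff_nat_ivl[of 0 "n - K" "Suc n" e] by (simp add: lessThan_atLeast0 atLeastLessThanSuc_atLeastAtMost)
    moreover have "(\<lambda>n. sum e {..<Suc n} - sum e {..<n - K}) \<longlonglongrightarrow> suminf e - suminf e"
      by (intro tendsto_diff LIMSEQ_Suc lim filterlim_compose[OF lim] filterlim_minus_const_nat_at_top)
    ultimately show ?thesis by simp
  qed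
  show ?thesis
  proof (rule ennreal_tendsto_zeroI[where A = "\<lambda>K. (a + real K) ^ k" and B = "C * B", OF tail])
    fix K n :: nat assume K: "1 \<le> K"
    let ?W = "\<lambda>\<omega>. (a + real (D n \<omega>)) ^ k * (\<Sum>i\<in>{n - D n \<omega>..n}. \<delta> i \<omega>)"
    let ?U = "\<lambda>\<omega>. ennreal ((a + real K) ^ k * (\<Sum>i\<in>{n - K..n}. \<delta> i \<omega>))"
    let ?V = "\<lambda>\<omega>. ennreal (C / K) * ennreal ((a + real (D n \<omega>)) ^ Suc k)"
    have "(\<integral>\<^sup>+\<omega>. ennreal (?W \<omega>) \<partial>M) \<le> (\<integral>\<^sup>+\<omega>. ?U \<omega> + ?V \<omega> \<partial>M)"
    proof (intro nn_integral_mono)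
      fix \<omega> assume \<omega>: "\<omega> \<in> space M"
      show "ennreal (?W \<omega>) \<le> ?U \<omega> + ?V \<omega>"
      proof (cases "D n \<omega> \<le> K")
        case True
        then have "?W \<omega> \<le> (a + real K) ^ k * (\<Sum>i\<in>{n - K..n}. \<delta> i \<omega>)"
          using nonneg \<delta>(2) by (intro mult_mono power_mono sum_mono2 sum_nonneg) auto
        then show ?thesis
          by (rule order_trans[OF ennreal_leI]) simp
      next
        case False
        have gain: "1 \<le> (a + real (D n \<omega>)) / K"
          using nonneg False K by simp
        have "?W \<omega> \<le> (a + real (D n \<omega>)) ^ k * C * 1"
          using nonneg by (simp add: mult_left_mono window \<omega>)
        also have "\<dots> \<le> (a + real (D n \<omega>)) ^ k * C * ((a + real (D n \<omega>)) / K)"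
          using nonneg by (intro mult_left_mono mult_nonneg_nonneg zero_le_power gain) auto
        also have "\<dots> = C / K * (a + real (D n \<omega>)) ^ Suc k"
          by simp
        finally have "ennreal (?W \<omega>) \<le> ennreal (C / K * (a + real (D n \<omega>)) ^ Suc k)"
          by (rule ennreal_leI)
        also have "\<dots> = ?V \<omega>"
          using nonneg by (intro ennreal_mult) auto
        finally show ?thesis
          by (rule order_trans) simp
      qed
    qed
    also have "\<dots> = (\<integral>\<^sup>+\<omega>. ?U \<omega> \<partial>M) + (\<integral>\<^sup>+\<omega>. ?V \<omega> \<partial>M)"
      by (intro nn_integral_add) measurable
    also have "(\<integral>\<^sup>+\<omega>. ?U \<omega> \<partial>M) = ennreal ((a + real K) ^ k * sum e {n - K..n})"
      using \<delta>(2) nonneg unfolding e_def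
      by (subst nn_integral_eq_integral) (auto simp: int intro!: mult_nonneg_nonneg sum_nonneg)
    also have "(\<integral>\<^sup>+\<omega>. ?V \<omega> \<partial>M) \<le> ennreal (C / K) * ennreal B"
      by (subst nn_integral_cmult) (auto intro!: mult_left_mono B simp del: power_Suc)
    also have "ennreal ((a + real K) ^ k * sum e {n - K..n}) + ennreal (C / K) * ennreal B
      = ennreal ((a + real K) ^ k * sum e {n - K..n} + C * B / real K)"
      using nonneg e0 by (simp add: ennreal_mult[symmetric] ennreal_plus[symmetric] sum_nonneg del: ennreal_plus)
    finally show "(\<integral>\<^sup>+\<omega>. ennreal (?W \<omega>) \<partial>M) \<le> ennreal ((a + real K) ^ k * sum e {n - K..n} + C * B / real K)"
      by (simp add: add_left_mono)
  qed
qed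

text \<open>The first moment follows from the second by
  \<open>X \<le> K * X\<^sup>2 + 1 / K\<close>. Only monotonicity of the integral is applied to
  \<open>Y\<close>, so it may be non-measurable.\<close>

lemma nn_integral_tendsto_zero_of_square:
  fixes X :: "nat \<Rightarrow> 'w \<Rightarrow> real" and Y :: "nat \<Rightarrow> 'w \<Rightarrow> ennreal"
  assumes M: "prob_space M" and X: "\<And>n. X n \<in> borel_measurable M"
    and lim: "(\<lambda>n. \<integral>\<^sup>+\<omega>. ennreal ((X n \<omega>)\<^sup>2) \<partial>M) \<longlonglongrightarrow> 0"
    and Y: "\<And>n \<omega>. 1 \<le> n \<Longrightarrow> \<omega> \<in> space M \<Longrightarrow> Y n \<omega> \<le> ennreal (X n \<omega>)"
  shows "(\<lambda>n. \<integral>\<^sup>+\<omega>. Y n \<omega> \<partial>M) \<longlonglongrightarrow> 0" "(\<lambda>n. \<integral>\<^sup>+\<omega>. (Y n \<omega>)\<^sup>2 \<partial>M) \<longlonglongrightarrow> 0"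
proof -
  interpret prob_space M by (rule M)
  note X[measurable]
  let ?w = "\<lambda>n. \<integral>\<^sup>+\<omega>. ennreal ((X n \<omega>)\<^sup>2) \<partial>M"
  show "(\<lambda>n. \<integral>\<^sup>+\<omega>. (Y n \<omega>)\<^sup>2 \<partial>M) \<longlonglongrightarrow> 0"
  proof (rule tendsto_sandwich[OF _ _ tendsto_const lim])
    show "\<forall>\<^sub>F n in sequentially. (\<integral>\<^sup>+\<omega>. (Y n \<omega>)\<^sup>2 \<partial>M) \<le> ?w n"
    proof (intro eventually_sequentiallyI[of 1] nn_integral_mono)
      fix n :: nat and \<omega> assume "1 \<le> n" "\<omega> \<in> space M"
      then have "(Y n \<omega>)\<^sup>2 \<le> (ennreal (X n \<omega>))\<^sup>2"
        by (intro power_mono Y) auto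
      also have "\<dots> \<le> ennreal ((X n \<omega>)\<^sup>2)"
        by (cases "0 \<le> X n \<omega>") (auto simp: ennreal_power ennreal_neg)
      finally show "(Y n \<omega>)\<^sup>2 \<le> ennreal ((X n \<omega>)\<^sup>2)" .
    qed
  qed auto
  have fin: "\<forall>\<^sub>F n in sequentially. ?w n < 1"
    by (rule order_tendstoD(2)[OF lim]) simp
  have "(\<lambda>n. enn2real (?w n)) \<longlonglongrightarrow> enn2real 0"
    by (rule tendsto_enn2real) (use lim in simp_all)
  then have w: "(\<lambda>n. enn2real (?w n)) \<longlonglongrightarrow> 0" by simp
  \<comment> \<open>\<open>enn2real\<close> sends an infinite integral to 0 and would break the
    bound; \<open>?Z\<close> blanks out those indices, of which there are finitely many by
    \<open>fin\<close>.\<close>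
  let ?Z = "\<lambda>n. if ?w n < 1 then \<integral>\<^sup>+\<omega>. Y n \<omega> \<partial>M else 0"
  have "?Z \<longlonglongrightarrow> 0"
  proof (rule ennreal_tendsto_zeroI[where A = real and B = 1, OF w])
    fix K n :: nat assume K: "1 \<le> K" and n: "1 \<le> n"
    show "?Z n \<le> ennreal (real K * enn2real (?w n) + 1 / real K)"
    proof (cases "?w n < 1")
      case True
      have "(\<integral>\<^sup>+\<omega>. Y n \<omega> \<partial>M) \<le> (\<integral>\<^sup>+\<omega>. ennreal (real K) * ennreal ((X n \<omega>)\<^sup>2) + ennreal (1 / K) \<partial>M)"
      proof (intro nn_integral_mono)
        fix \<omega> assume "\<omega> \<in> space M"
        have "X n \<omega> \<le> real K * (X n \<omega>)\<^sup>2 + 1 / K"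
        proof (cases "X n \<omega> \<le> 1 / K")
          case False
          then have "1 * X n \<omega> \<le> (real K * X n \<omega>) * X n \<omega>"
            using K order_trans[of 0 "1 / real K" "X n \<omega>"] by (intro mult_right_mono) (auto simp: field_simps)
          moreover have "(real K * X n \<omega>) * X n \<omega> = real K * (X n \<omega>)\<^sup>2"
            by (simp add: power2_eq_square)
          moreover have "0 \<le> 1 / real K" by simp
          ultimately show ?thesis by linarith
        qed (simp add: add_increasing)
        then have "ennreal (X n \<omega>) \<le> ennreal (real K * (X n \<omega>)\<^sup>2 + 1 / K)"
          by (rule ennreal_leI)
        also have "\<dots> = ennreal (real K) * ennreal ((X n \<omega>)\<^sup>2) + ennreal (1 / K)"
          by (simp add: ennreal_mult)
        finally show "Y n \<omega> \<le> ennreal (real K) * ennreal ((X n \<omega>)\<^sup>2) + ennreal (1 / K)"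
          using Y[OF n \<open>\<omega> \<in> space M\<close>] by (rule order_trans[rotated])
      qed
      also have "\<dots> = ennreal (real K) * ?w n + ennreal (1 / K)"
        by (simp add: nn_integral_add nn_integral_cmult emeasure_space_1)
      also have "?w n = ennreal (enn2real (?w n))"
        using order_less_trans[OF True] by simp
      finally show ?thesis
        using True by (simp add: ennreal_mult enn2real_nonneg)
    qed simp
  qed
  then show "(\<lambda>n. \<integral>\<^sup>+\<omega>. Y n \<omega> \<partial>M) \<longlonglongrightarrow> 0"
    by (rule Lim_transform_eventually) (use fin in eventually_elim, simp)
qed

text \<open>An index \<open>i < n\<close> lies in the window of \<open>n\<close> exactly if
  \<open>n - i \<le> D n \<omega>\<close>. The expected window sums are thus dominated by the
  convolution of \<open>a\<close> with a geometric sequence, and a finite expected total forces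
  summability almost everywhere.\<close>

lemma AE_summable_window:
  fixes D :: "nat \<Rightarrow> 'w \<Rightarrow> nat" and a :: "nat \<Rightarrow> real"
  assumes D: "\<And>n. D n \<in> M \<rightarrow>\<^sub>M count_space UNIV"
    and tail: "\<And>n j. emeasure M {\<omega> \<in> space M. j \<le> D n \<omega>} \<le> ennreal (c * q ^ j)"
    and q: "0 < c" "0 < q" "q < 1"
    and a: "\<And>i. 0 \<le> a i" "summable a"
  shows "AE \<omega> in M. summable (\<lambda>n. \<Sum>i\<in>{n - D n \<omega>..<n}. a i)"
proof -
  note [measurable] = D
  have [measurable]: "{\<omega> \<in> space M. j \<le> D n \<omega>} \<in> sets M" for j n by measurable
  let ?S = "\<lambda>n \<omega>. \<Sum>i<n. a i * indicator {\<omega> \<in> space M. n - i \<le> D n \<omega>} \<omega>"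
  \<comment> \<open>The extra term \<open>i = n\<close> gives this sum the shape of a Cauchy
    product.\<close>
  let ?c = "\<lambda>n. \<Sum>i\<le>n. a i * (c * q ^ (n - i))"
  have S: "?S n \<omega> = (\<Sum>i\<in>{n - D n \<omega>..<n}. a i)" if "\<omega> \<in> space M" for n \<omega>
  proof -
    have "?S n \<omega> = (\<Sum>i<n. if n - D n \<omega> \<le> i then a i else 0)"
      using that by (intro sum.cong) (auto split: split_indicator)
    also have "\<dots> = sum a ({..<n} \<inter> {i. n - D n \<omega> \<le> i})"
      by (simp add: sum.inter_restrict)
    also have "{..<n} \<inter> {i. n - D n \<omega> \<le> i} = {n - D n \<omega>..<n}" by auto
    finally show ?thesis .
  qed
  have S0: "0 \<le> ?S n \<omega>" for n \<omega>
    using a(1) by (intro sum_nonneg mult_nonneg_nonneg) auto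
  have c0: "0 \<le> ?c n" for n
    using a(1) q by (intro sum_nonneg mult_nonneg_nonneg) auto
  have "summable ?c"
    using a q by (intro summable_Cauchy_product) (auto intro!: summable_mult summable_geometric)
  have le: "(\<integral>\<^sup>+\<omega>. ennreal (?S n \<omega>) \<partial>M) \<le> ennreal (?c n)" for n
  proof -
    have "(\<integral>\<^sup>+\<omega>. ennreal (?S n \<omega>) \<partial>M)
      = (\<integral>\<^sup>+\<omega>. (\<Sum>i<n. ennreal (a i) * indicator {\<omega> \<in> space M. n - i \<le> D n \<omega>} \<omega>) \<partial>M)"
      using a(1) by (intro nn_integral_cong) (simp add: ennreal_mult ennreal_indicator flip: sum_ennreal)
    also have "\<dots> = (\<Sum>i<n. \<integral>\<^sup>+\<omega>. ennreal (a i) * indicator {\<omega> \<in> space M. n - i \<le> D n \<omega>} \<omega> \<partial>M)"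
      by (rule nn_integral_sum) measurable
    also have "\<dots> = (\<Sum>i<n. ennreal (a i) * emeasure M {\<omega> \<in> space M. n - i \<le> D n \<omega>})"
      by (intro sum.cong refl nn_integral_cmult_indicator) measurable
    also have "\<dots> \<le> (\<Sum>i<n. ennreal (a i) * ennreal (c * q ^ (n - i)))"
      by (intro sum_mono mult_left_mono tail) auto
    also have "\<dots> = ennreal (\<Sum>i<n. a i * (c * q ^ (n - i)))"
      using a(1) q by (simp add: ennreal_mult flip: sum_ennreal)
    also have "\<dots> \<le> ennreal (?c n)"
      using a(1) q by (intro ennreal_leI sum_mono2) auto
    finally show ?thesis .
  qed
  have "(\<integral>\<^sup>+\<omega>. (\<Sum>n. ennreal (?S n \<omega>)) \<partial>M) = (\<Sum>n. \<integral>\<^sup>+\<omega>. ennreal (?S n \<omega>) \<partial>M)"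
    by (intro nn_integral_suminf) measurable
  also have "\<dots> \<le> (\<Sum>n. ennreal (?c n))"
    by (intro suminf_le le) auto
  also have "\<dots> = ennreal (suminf ?c)"
    by (rule suminf_ennreal2[OF c0 \<open>summable ?c\<close>])
  also have "\<dots> < \<infinity>" by simp
  finally have fin: "(\<integral>\<^sup>+\<omega>. (\<Sum>n. ennreal (?S n \<omega>)) \<partial>M) < \<infinity>" .
  have "AE \<omega> in M. (\<Sum>n. ennreal (?S n \<omega>)) \<noteq> \<infinity>"
  proof (rule nn_integral_noteq_infinite)
    show "(\<lambda>\<omega>. \<Sum>n. ennreal (?S n \<omega>)) \<in> borel_measurable M" by measurable
  qed (rule less_imp_neq[OF fin])
  then show ?thesis
  proof (rule AE_mp, intro AE_I2 impI)
    fix \<omega> assume \<omega>: "\<omega> \<in> space M" "(\<Sum>n. ennreal (?S n \<omega>)) \<noteq> \<infinity>"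
    have "summable (\<lambda>n. ?S n \<omega>)"
      by (rule summable_suminf_not_top[OF S0]) (use \<omega>(2) in \<open>simp only: infinity_ennreal_def not_False_eq_True\<close>)
    then show "summable (\<lambda>n. \<Sum>i\<in>{n - D n \<omega>..<n}. a i)"
      by (simp only: S[OF \<omega>(1)])
  qed
qed

section \<open>From pathwise bounds to the two conclusions\<close>

lemma weighted_sum_bdd_below:
  assumes p: "\<And>u. u \<in> V \<Longrightarrow> 0 \<le> p u" and f: "\<And>u. u \<in> V \<Longrightarrow> bdd_below (f u ` \<Theta>)"
  obtains B where "\<And>x. x \<in> \<Theta> \<Longrightarrow> B \<le> weighted_sum V p f x"
proof
  fix x assume x: "x \<in> \<Theta>"
  show "(\<Sum>u\<in>V. p u * (INF x\<in>\<Theta>. f u x)) \<le> weighted_sum V p f x"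
    unfolding weighted_sum_def by (intro sum_mono mult_left_mono cINF_lower f p x)
qed

lemma weighted_sum_lipschitz_gradient:
  assumes p: "\<And>u. u \<in> V \<Longrightarrow> 0 \<le> p u" "(\<Sum>u\<in>V. p u) = 1" and L: "0 \<le> L"
    and f: "\<And>u. u \<in> V \<Longrightarrow> lipschitz_gradient L (f u)"
  shows "lipschitz_gradient L (weighted_sum V p f)"
proof -
  obtain G where "\<And>u x. u \<in> V \<Longrightarrow> GDERIV (f u) x :> G u x" "\<And>u. u \<in> V \<Longrightarrow> L-lipschitz_on UNIV (G u)"
    using f unfolding lipschitz_gradient_def by metis
  then show ?thesis
    unfolding lipschitz_gradient_def
    by (intro exI[of _ "\<lambda>x. \<Sum>u\<in>V. p u *\<^sub>R G u x"] conjI allI GDERIV_weighted_sum lipschitz_weighted_sum p L)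
qed

text \<open>Squaring the pathwise gap bound gives two factors \<open>a + D\<close>, and
  Cauchy-Schwarz on the window sum a third. The window lemma is therefore used with exponent 3,
  which calls for a fourth moment of the lag.\<close>

lemma algorithm1_expected_gap:
  fixes \<theta> :: "nat \<Rightarrow> 'w \<Rightarrow> 'a::euclidean_space"
  assumes M: "prob_space M"
    and V: "finite V" "V \<noteq> {}" and p: "\<And>u. u \<in> V \<Longrightarrow> 0 \<le> p u" "(\<Sum>u\<in>V. p u) = 1"
    and \<Theta>: "convex \<Theta>" and L: "0 \<le> L"
    and v: "\<And>n. n \<ge> 1 \<Longrightarrow> v n \<in> M \<rightarrow>\<^sub>M count_space V"
    and \<theta>: "\<And>n. \<theta> n \<in> borel_measurable M" "\<And>\<omega>. \<omega> \<in> space M \<Longrightarrow> \<theta> 0 \<omega> = \<theta>\<^sub>0"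
    and rec: "recurrent_sampling M V v \<theta>"
    and bdd: "\<And>u. u \<in> V \<Longrightarrow> bdd_below (f u ` \<Theta>)"
    and dir: "\<And>u x y. u \<in> V \<Longrightarrow> x \<in> \<Theta> \<Longrightarrow> y \<in> \<Theta> \<Longrightarrow> has_dir_deriv (f u) x (y - x)"
    and reg: "0 \<le> \<rho>" "0 < \<rho> + \<mu>"
    and alg: "\<And>\<omega>. \<omega> \<in> space M \<Longrightarrow>
      algorithm1_path V p \<Theta> f L \<rho> \<mu> (\<lambda>n. v n \<omega>) (\<lambda>n. \<theta> n \<omega>) (\<lambda>n. g n \<omega>)"
  shows "(\<lambda>n. \<integral>\<^sup>+\<omega>. e2ennreal (opt_gap \<Theta> (weighted_sum V p f) (\<theta> n \<omega>)) \<partial>M) \<longlonglongrightarrow> 0"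
    and "(\<lambda>n. \<integral>\<^sup>+\<omega>. (e2ennreal (opt_gap \<Theta> (weighted_sum V p f) (\<theta> n \<omega>)))\<^sup>2 \<partial>M) \<longlonglongrightarrow> 0"
proof -
  interpret prob_space M by (rule M)
  let ?f = "weighted_sum V p f"
  define D where "D = (\<lambda>n \<omega>. max_lag V (\<lambda>i. v i \<omega>) n)"
  define \<delta> where "\<delta> = (\<lambda>i \<omega>. norm (\<theta> i \<omega> - \<theta> (i - 1) \<omega>))"
  \<comment> \<open>The summand 1 makes \<open>a + D\<close> dominate both
    \<open>\<rho> + L + D\<close> and the number of indices in the window, at most
    \<open>D + 1\<close>.\<close>
  define a where "a = \<rho> + L + 1"
  have a: "1 \<le> a" using reg L by (simp add: a_def)
  have D[measurable]: "D n \<in> M \<rightarrow>\<^sub>M count_space UNIV" for n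
    unfolding D_def by (rule max_lag_measurable[OF V v])
  note \<theta>(1)[measurable]
  have \<delta>[measurable]: "\<delta> i \<in> borel_measurable M" for i
    unfolding \<delta>_def by measurable
  have \<delta>0: "0 \<le> \<delta> i \<omega>" for i \<omega> by (simp add: \<delta>_def)
  obtain c q where cq: "0 < c" "0 < q" "q < 1"
    and tail: "\<And>n j. emeasure M {\<omega> \<in> space M. j \<le> D n \<omega>} \<le> ennreal (c * q ^ j)"
    using max_lag_tail[OF M V v \<theta>(1) rec] unfolding D_def by blast
  have "0 \<le> a" using a by simp
  obtain B where B: "0 \<le> B" "\<And>n. (\<integral>\<^sup>+\<omega>. ennreal ((a + real (D n \<omega>)) ^ Suc 3) \<partial>M) \<le> ennreal B"
    by (rule geometric_tail_moment[of D M c q a "Suc 3", OF D tail cq \<open>0 \<le> a\<close>]) (assumption | rule that)+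
  obtain m where m: "\<And>x. x \<in> \<Theta> \<Longrightarrow> m \<le> ?f x"
    by (rule weighted_sum_bdd_below[of V p f \<Theta>, OF p(1) bdd]) (assumption | rule that)+
  \<comment> \<open>The telescoped bound divided by the descent constant
    \<open>(\<rho> + \<mu>) / 4\<close>; the fixed start \<open>\<theta>\<^sub>0\<close> makes it
    the same on all paths, and \<open>max 0\<close> supplies nonnegativity.\<close>
  define C where "C = max 0 (4 * (?f \<theta>\<^sub>0 - m) / (\<rho> + \<mu>))"
  have C: "(\<Sum>i\<le>n. (\<delta> i \<omega>)\<^sup>2) \<le> C" if \<omega>: "\<omega> \<in> space M" for n \<omega>
  proof -
    have "(\<Sum>i\<le>n. (\<delta> i \<omega>)\<^sup>2) = (\<Sum>i\<in>{1..n}. (\<delta> i \<omega>)\<^sup>2)"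
      \<comment> \<open>\<open>\<delta> 0 = 0\<close> because \<open>0 - 1 = 0\<close> on \<open>nat\<close>\<close>
      by (intro sum.mono_neutral_right) (auto simp: \<delta>_def not_le)
    moreover have "(\<rho> + \<mu>) / 4 * (\<Sum>i\<in>{1..n}. (\<delta> i \<omega>)\<^sup>2) \<le> ?f (\<theta> 0 \<omega>) - ?f (\<theta> n \<omega>)"
      unfolding \<delta>_def by (rule algorithm1_sum_steps[OF alg[OF \<omega>] V p \<Theta> reg(1)])
    moreover have "m \<le> ?f (\<theta> n \<omega>)"
      by (rule m[OF algorithm1_in_domain[OF alg[OF \<omega>]]])
    ultimately have "(\<rho> + \<mu>) / 4 * (\<Sum>i\<le>n. (\<delta> i \<omega>)\<^sup>2) \<le> ?f \<theta>\<^sub>0 - m"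
      by (simp add: \<theta>(2)[OF \<omega>])
    then have "(\<Sum>i\<le>n. (\<delta> i \<omega>)\<^sup>2) \<le> 4 * (?f \<theta>\<^sub>0 - m) / (\<rho> + \<mu>)"
      using reg by (simp add: field_simps)
    then show ?thesis by (simp add: C_def)
  qed
  \<comment> \<open>The random window is written as a guarded sum over a fixed range, which makes
    measurability immediate; \<open>window\<close> translates back.\<close>
  define X where "X = (\<lambda>n \<omega>. (\<rho> + L + real (D n \<omega>)) * (\<Sum>i\<le>n. if n - D n \<omega> \<le> i then \<delta> i \<omega> else 0))"
  have X[measurable]: "X n \<in> borel_measurable M" for n
    unfolding X_def by measurable
  have window: "(\<Sum>i\<le>n. if n - d \<le> i then h i else 0) = sum h {n - d..n}" for n d and h :: "nat \<Rightarrow> real"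
  proof -
    have "{n - d..n} = {..n} \<inter> {i. n - d \<le> i}" by auto
    then show ?thesis
      by (simp only: sum.inter_restrict finite_atMost mem_Collect_eq)
  qed
  have square: "(X n \<omega>)\<^sup>2 \<le> (a + real (D n \<omega>)) ^ 3 * (\<Sum>i\<in>{n - D n \<omega>..n}. (\<delta> i \<omega>)\<^sup>2)" for n \<omega>
  proof -
    let ?I = "{n - D n \<omega>..n}" and ?b = "a + real (D n \<omega>)"
    have "(sum (\<lambda>i. \<delta> i \<omega>) ?I)\<^sup>2 \<le> real (card ?I) * (\<Sum>i\<in>?I. (\<delta> i \<omega>)\<^sup>2)"
      using sum_squared_le_sum_of_squares[of "\<lambda>i. \<delta> i \<omega>" ?I] by (simp only: mult.commute)
    also have "\<dots> \<le> ?b * (\<Sum>i\<in>?I. (\<delta> i \<omega>)\<^sup>2)"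
      using a by (intro mult_right_mono sum_nonneg) auto
    finally have 1: "(sum (\<lambda>i. \<delta> i \<omega>) ?I)\<^sup>2 \<le> ?b * (\<Sum>i\<in>?I. (\<delta> i \<omega>)\<^sup>2)" .
    have 2: "(\<rho> + L + real (D n \<omega>))\<^sup>2 \<le> ?b\<^sup>2"
      using reg(1) L by (intro power_mono) (auto simp: a_def)
    have "(X n \<omega>)\<^sup>2 = (\<rho> + L + real (D n \<omega>))\<^sup>2 * (sum (\<lambda>i. \<delta> i \<omega>) ?I)\<^sup>2"
      by (simp add: X_def window power_mult_distrib)
    also have "\<dots> \<le> ?b\<^sup>2 * (?b * (\<Sum>i\<in>?I. (\<delta> i \<omega>)\<^sup>2))"
      by (intro mult_mono 1 2) auto
    finally show ?thesis
      by (simp add: power2_eq_square power3_eq_cube mult.assoc)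
  qed
  have "(\<lambda>n. \<integral>\<^sup>+\<omega>. ennreal ((a + real (D n \<omega>)) ^ 3 * (\<Sum>i\<in>{n - D n \<omega>..n}. (\<delta> i \<omega>)\<^sup>2)) \<partial>M) \<longlonglongrightarrow> 0"
    by (rule expected_window_tendsto_zero[OF M D _ _ C B(2) \<open>0 \<le> a\<close> B(1)]) (auto simp: C_def)
  then have lim: "(\<lambda>n. \<integral>\<^sup>+\<omega>. ennreal ((X n \<omega>)\<^sup>2) \<partial>M) \<longlonglongrightarrow> 0"
    by (rule tendsto_sandwich[OF _ _ tendsto_const, rotated -1])
      (auto intro!: always_eventually nn_integral_mono ennreal_leI square)
  have gap: "e2ennreal (opt_gap \<Theta> ?f (\<theta> n \<omega>)) \<le> ennreal (X n \<omega>)"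
    if "1 \<le> n" "\<omega> \<in> space M" for n \<omega>
  proof -
    have "opt_gap \<Theta> ?f (\<theta> n \<omega>) \<le> ereal (X n \<omega>)"
      using algorithm1_opt_gap[OF alg[OF that(2)] V p \<Theta> reg(1) L that(1) dir]
      by (simp add: X_def window D_def \<delta>_def)
    then show ?thesis
      using e2ennreal_mono by fastforce
  qed
  show "(\<lambda>n. \<integral>\<^sup>+\<omega>. e2ennreal (opt_gap \<Theta> ?f (\<theta> n \<omega>)) \<partial>M) \<longlonglongrightarrow> 0"
    "(\<lambda>n. \<integral>\<^sup>+\<omega>. (e2ennreal (opt_gap \<Theta> ?f (\<theta> n \<omega>)))\<^sup>2 \<partial>M) \<longlonglongrightarrow> 0"
    using nn_integral_tendsto_zero_of_square[OF M X lim gap] by simp_all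
qed

text \<open>Supplies \<open>limit_point_stationary\<close> with a summable progress bound: the
  decrements of a convergent sequence, the squared radii and the window sums.\<close>

lemma algorithm2_limit_point_stationary:
  fixes \<theta> :: "nat \<Rightarrow> 'a::real_inner"
  assumes alg: "algorithm2_path V p \<Theta> f L r v \<theta> g"
    and V: "finite V" "V \<noteq> {}" and p: "\<And>u. u \<in> V \<Longrightarrow> 0 \<le> p u" "(\<Sum>u\<in>V. p u) = 1"
    and \<Theta>: "convex \<Theta>" and L: "0 \<le> L"
    and bdd: "\<And>u. u \<in> V \<Longrightarrow> bdd_below (f u ` \<Theta>)"
    and smooth: "\<And>u. u \<in> V \<Longrightarrow> lipschitz_gradient L (f u)"
    and r: "\<And>n. 1 \<le> n \<Longrightarrow> 0 < r n" "antimono_on {1..} r"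
      "\<not> summable (\<lambda>n. r (Suc n))" "summable (\<lambda>n. (r (Suc n))\<^sup>2)"
    and lag: "summable (\<lambda>n. \<Sum>i\<in>{n - max_lag V v n..<n}. (r i)\<^sup>2)"
    and x: "x \<in> \<Theta>" "seq_limit_point (\<lambda>n. \<theta> (Suc n)) x"
  shows "stationary_point \<Theta> (weighted_sum V p f) x"
proof -
  let ?f = "weighted_sum V p f"
  have "lipschitz_gradient L ?f"
    by (rule weighted_sum_lipschitz_gradient[OF p L smooth])
  then obtain F where F: "\<And>x. GDERIV ?f x :> F x" "L-lipschitz_on UNIV F"
    unfolding lipschitz_gradient_def by blast
  obtain m where m: "\<And>x. x \<in> \<Theta> \<Longrightarrow> m \<le> ?f x"
    by (rule weighted_sum_bdd_below[of V p f \<Theta>, OF p(1) bdd]) (assumption | rule that)+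
  \<comment> \<open>These values are non-increasing and bounded below by a bound for the objective,
    so their decrements are summable.\<close>
  define w where "w = (\<lambda>n. weighted_sum V p (g n) (\<theta> n))"
  have w_Suc: "w (Suc n) \<le> w n" for n
  proof -
    have "\<theta> n \<in> \<Theta> \<inter> cball (\<theta> n) (r (Suc n))"
      using algorithm2_in_domain[OF alg] r(1)[of "Suc n"] by simp
    then have "w (Suc n) \<le> weighted_sum V p (g (Suc n)) (\<theta> n)"
      using is_arg_min_le[OF algorithm2_pathD(5)[OF alg, of "Suc n"], of "\<theta> n"] by (simp add: w_def)
    also have "\<dots> \<le> w n"
      using algorithm2_surrogate_decreases[OF alg p(1), of "Suc n"] by (simp add: w_def)
    finally show ?thesis .
  qed
  have w_lower: "m \<le> w n" for n
  proof -
    have "m \<le> ?f (\<theta> n)"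
      by (rule m[OF algorithm2_in_domain[OF alg]])
    also have "\<dots> \<le> w n"
      unfolding w_def
      by (rule weighted_sum_surrogates(1)[OF algorithm2_stored[OF alg] p(1) algorithm2_in_domain[OF alg]])
    finally show ?thesis .
  qed
  have "decseq w"
    by (rule decseq_SucI) (rule w_Suc)
  then obtain l where "w \<longlonglongrightarrow> l"
    using decseq_convergent[of w m] w_lower by blast
  then have w_sum: "summable (\<lambda>n. w n - w (Suc n))"
    by (rule telescope_summable')
  \<comment> \<open>Entry \<open>n\<close> concerns the step from \<open>\<theta> n\<close> to
    \<open>\<theta> (Suc n)\<close>, whose radius is \<open>r (Suc n)\<close>.\<close>
  define b where "b = (\<lambda>n. w n - w (Suc n) + 2 * L * (r (Suc n))\<^sup>2
    + L * (\<Sum>i\<in>{Suc n - max_lag V v (Suc n)..<Suc n}. (r i)\<^sup>2))"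
  have b: "summable b"
    unfolding b_def
    by (intro summable_add summable_mult w_sum r(4)
        iffD2[OF summable_Suc_iff[of "\<lambda>n. \<Sum>i\<in>{n - max_lag V v n..<n}. (r i)\<^sup>2"]] lag)
  have b0: "0 \<le> b n" for n
    unfolding b_def using L w_Suc[of n] by (intro add_nonneg_nonneg mult_nonneg_nonneg sum_nonneg) auto
  \<comment> \<open>Square summability drives the radii to 0; \<open>algorithm2_descent\<close>
    applies once they are at most 1.\<close>
  have "\<forall>\<^sub>F n in sequentially. (r (Suc n))\<^sup>2 < 1"
    using summable_LIMSEQ_zero[OF r(4)] by (rule order_tendstoD(2)) simp
  then obtain N where "\<And>n. N \<le> n \<Longrightarrow> (r (Suc n))\<^sup>2 < 1"
    unfolding eventually_sequentially by blast
  then have N: "r (Suc n) \<le> 1" if "N \<le> n" for n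
    using that power2_le_imp_le[of "r (Suc n)" 1] by (simp add: less_imp_le)
  show ?thesis
  proof (rule limit_point_stationary[OF \<Theta> x(1) F(1) _ _ r(3) b0 b])
    show "continuous_on UNIV F"
      by (rule lipschitz_on_continuous_on[OF F(2)])
    show "0 < r (Suc n)" for n
      using r(1) by simp
    show "norm (\<theta> (Suc n) - \<theta> n) \<le> r (Suc n)" for n
      using algorithm2_step_le[OF alg, of "Suc n"] by simp
    show "r (Suc n) * (- inner (F (\<theta> n)) (y - \<theta> n)) \<le> b n"
      if "N \<le> n" "y \<in> \<Theta>" "norm (y - \<theta> n) \<le> 1" for n y
      using algorithm2_descent[OF alg V p \<Theta> L _ r(1,2) N[OF that(1)] F that(2)] that(3)
      by (simp add: b_def w_def)
    obtain s where "strict_mono s" "((\<lambda>n. \<theta> (Suc n)) \<circ> s) \<longlonglongrightarrow> x"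
      using x(2) unfolding seq_limit_point_def by blast
    then show "seq_limit_point \<theta> x"
      unfolding seq_limit_point_def
      by (intro exI[of _ "Suc \<circ> s"]) (auto simp: strict_mono_def o_def)
  qed
qed

text \<open>\<open>opt_gap\<close> is nonnegative on \<open>\<Theta>\<close>, where all iterates
  lie, so \<open>e2ennreal\<close> preserves its value and the expectations are nonnegative
  integrals. Radii start at time 1, hence the shifts by \<open>Suc\<close>.\<close>

theorem theorem3p9:
  fixes M :: "'w measure"
    and V :: "'v set"
    and p :: "'v \<Rightarrow> real"
    and \<Theta> :: "(real ^ 'p) set"
    and f :: "'v \<Rightarrow> real ^ 'p \<Rightarrow> real"
    and L :: real
    and v :: "nat \<Rightarrow> 'w \<Rightarrow> 'v"
    and \<theta> :: "nat \<Rightarrow> 'w \<Rightarrow> real ^ 'p"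
    and \<theta>\<^sub>0 :: "real ^ 'p"
  assumes prob: "prob_space M"
    and V: "finite V" "V \<noteq> {}"
    and p: "\<And>u. u \<in> V \<Longrightarrow> 0 \<le> p u" "(\<Sum>u\<in>V. p u) = 1"
    and \<Theta>: "\<Theta> \<noteq> {}" "convex \<Theta>"
    and L: "0 < L"
    and v_meas: "\<And>n. n \<ge> 1 \<Longrightarrow> v n \<in> M \<rightarrow>\<^sub>M count_space V"
    and \<theta>_meas: "\<And>n. \<theta> n \<in> borel_measurable M"
    and \<theta>_init: "\<And>\<omega>. \<omega> \<in> space M \<Longrightarrow> \<theta> 0 \<omega> = \<theta>\<^sub>0"
    and recurrent: "recurrent_sampling M V v \<theta>"
    and bdd: "\<And>u. u \<in> V \<Longrightarrow> bdd_below (f u ` \<Theta>)"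
    and dir: "\<And>u x y. u \<in> V \<Longrightarrow> x \<in> \<Theta> \<Longrightarrow> y \<in> \<Theta> \<Longrightarrow> has_dir_deriv (f u) x (y - x)"
  shows
    "(\<forall>\<rho> \<mu> (g :: nat \<Rightarrow> 'w \<Rightarrow> 'v \<Rightarrow> real ^ 'p \<Rightarrow> real).
        0 \<le> \<rho> \<longrightarrow> 0 \<le> \<mu> \<longrightarrow> 0 < \<rho> + \<mu> \<longrightarrow>
        (\<forall>\<omega>\<in>space M. algorithm1_path V p \<Theta> f L \<rho> \<mu> (\<lambda>n. v n \<omega>) (\<lambda>n. \<theta> n \<omega>) (\<lambda>n. g n \<omega>)) \<longrightarrow>
        (\<lambda>n. \<integral>\<^sup>+\<omega>. e2ennreal (opt_gap \<Theta> (weighted_sum V p f) (\<theta> n \<omega>)) \<partial>M) \<longlonglongrightarrow> 0 \<and>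
        (\<lambda>n. \<integral>\<^sup>+\<omega>. (e2ennreal (opt_gap \<Theta> (weighted_sum V p f) (\<theta> n \<omega>)))\<^sup>2 \<partial>M) \<longlonglongrightarrow> 0)
     \<and>
     (\<forall>(r :: nat \<Rightarrow> real) (g :: nat \<Rightarrow> 'w \<Rightarrow> 'v \<Rightarrow> real ^ 'p \<Rightarrow> real).
        (\<forall>u\<in>V. lipschitz_gradient L (f u)) \<longrightarrow>
        (\<forall>n\<ge>1. 0 < r n) \<longrightarrow> antimono_on {1..} r \<longrightarrow>
        \<not> summable (\<lambda>n. r (Suc n)) \<longrightarrow> summable (\<lambda>n. (r (Suc n))\<^sup>2) \<longrightarrow>
        (\<forall>\<omega>\<in>space M. algorithm2_path V p \<Theta> f L r (\<lambda>n. v n \<omega>) (\<lambda>n. \<theta> n \<omega>) (\<lambda>n. g n \<omega>)) \<longrightarrow>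
        (AE \<omega> in M. \<forall>x\<in>\<Theta>. seq_limit_point (\<lambda>n. \<theta> (Suc n) \<omega>) x \<longrightarrow>
           stationary_point \<Theta> (weighted_sum V p f) x))"
proof (intro conjI allI impI)
  fix \<rho> \<mu> and g :: "nat \<Rightarrow> 'w \<Rightarrow> 'v \<Rightarrow> real ^ 'p \<Rightarrow> real"
  assume reg: "0 \<le> \<rho>" "0 < \<rho> + \<mu>"
    and alg: "\<forall>\<omega>\<in>space M. algorithm1_path V p \<Theta> f L \<rho> \<mu> (\<lambda>n. v n \<omega>) (\<lambda>n. \<theta> n \<omega>) (\<lambda>n. g n \<omega>)"
  have "0 \<le> L" using L by simp
  note gap = algorithm1_expected_gap[OF prob V p \<Theta>(2) \<open>0 \<le> L\<close> v_meas \<theta>_meas \<theta>_init recurrent bdd dir reg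
      bspec[OF alg]]
  show "(\<lambda>n. \<integral>\<^sup>+\<omega>. e2ennreal (opt_gap \<Theta> (weighted_sum V p f) (\<theta> n \<omega>)) \<partial>M) \<longlonglongrightarrow> 0"
    by (rule gap)
  show "(\<lambda>n. \<integral>\<^sup>+\<omega>. (e2ennreal (opt_gap \<Theta> (weighted_sum V p f) (\<theta> n \<omega>)))\<^sup>2 \<partial>M) \<longlonglongrightarrow> 0"
    by (rule gap)
next
  fix r :: "nat \<Rightarrow> real" and g :: "nat \<Rightarrow> 'w \<Rightarrow> 'v \<Rightarrow> real ^ 'p \<Rightarrow> real"
  assume smooth: "\<forall>u\<in>V. lipschitz_gradient L (f u)"
    and r: "\<forall>n\<ge>1. 0 < r n" "antimono_on {1..} r"
      "\<not> summable (\<lambda>n. r (Suc n))" "summable (\<lambda>n. (r (Suc n))\<^sup>2)"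
    and alg: "\<forall>\<omega>\<in>space M. algorithm2_path V p \<Theta> f L r (\<lambda>n. v n \<omega>) (\<lambda>n. \<theta> n \<omega>) (\<lambda>n. g n \<omega>)"
  obtain c q where cq: "0 < c" "0 < q" "q < 1"
    and tail: "\<And>n j. emeasure M {\<omega> \<in> space M. j \<le> max_lag V (\<lambda>i. v i \<omega>) n} \<le> ennreal (c * q ^ j)"
    using max_lag_tail[OF prob V v_meas \<theta>_meas recurrent] by blast
  have "summable (\<lambda>n. (r n)\<^sup>2)"
    using r(4) by (subst (asm) summable_Suc_iff)
  then have "AE \<omega> in M. summable (\<lambda>n. \<Sum>i\<in>{n - max_lag V (\<lambda>i. v i \<omega>) n..<n}. (r i)\<^sup>2)"
    by (intro AE_summable_window[OF max_lag_measurable[OF V v_meas] tail cq]) simp_all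
  then show "AE \<omega> in M. \<forall>x\<in>\<Theta>. seq_limit_point (\<lambda>n. \<theta> (Suc n) \<omega>) x \<longrightarrow>
    stationary_point \<Theta> (weighted_sum V p f) x"
  \<comment> \<open>The exceptional null set comes from the samples and the radii alone, so it
    serves all limit points at once.\<close>
  proof (rule AE_mp, intro AE_I2 impI ballI)
    fix \<omega> x
    assume "\<omega> \<in> space M" "x \<in> \<Theta>" "seq_limit_point (\<lambda>n. \<theta> (Suc n) \<omega>) x"
      and "summable (\<lambda>n. \<Sum>i\<in>{n - max_lag V (\<lambda>i. v i \<omega>) n..<n}. (r i)\<^sup>2)"
    then show "stationary_point \<Theta> (weighted_sum V p f) x"
      using alg smooth r L
      by (intro algorithm2_limit_point_stationary[OF _ V p \<Theta>(2) _ bdd, where r = r and v = "\<lambda>n. v n \<omega>"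
            and \<theta> = "\<lambda>n. \<theta> n \<omega>" and g = "\<lambda>n. g n \<omega>"]) auto
  qed
qed

end
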